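(* Consider the linear model with deterministic $n\times p$ design matrix $\mathbf{X}$ ($p=p_n$) described in the context, the projection $\boldsymbol{\theta}$ of $\boldsymbol{\beta}$ onto the row space of $\mathbf{X}$, and the ridge regression estimator $\hat{\boldsymbol{\theta}}=(\mathbf{X}'\mathbf{X}+h_n\mathbf{I}_p)^{-1}\mathbf{X}'\mathbf{y}$. Let $\lambda_{1n}$ be the smallest positive eigenvalue of $\mathbf{X}'\mathbf{X}$. Assume that 1. $E(\varepsilon_i^k)<\infty$ for an even integer $k$ not depending on $n$; 2. $\lambda_{1n}^{-1}=O(n^{-\eta})$, where $\eta\le1$ does not depend on $n$; 3. $\|\boldsymbol{\theta}\|=O(n^{\tau})$, where $\tau<\eta$ does not depend on $n$; 4. $p=O(n^l)$, where $1\le l<k/6$ and $l$ does not depend on $n$. For any $t>0$, let $\xi=3l(t+1)/k$, let $a_n=C_1n^{-\alpha}$, where $C_1>0$ and $0<\alpha\le1/2$ do not depend on $n$ and $\alpha\le(\eta-\xi-\tau)/3$, and let $u_n=1+(\log\log n)^{-1}$. If $h_n=C_2a_n^{-2}(\log\log n)^2(n\vee p)^{2\xi/(3l)}$, where $C_2>0$ is a constant, then $$P\bigl(\mathcal{M}_{\boldsymbol{\theta},a_nu_n}\subset\mathcal{M}_{\hat{\boldsymbol{\theta}},a_n}\subset\mathcal{M}_{\boldsymbol{\theta},a_n/u_n}\bigr)=1-O\bigl((n\vee p)^{-t}\bigr)$$ as $n\to\infty$.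
   Context: Model: for each $n$, $y_i=\mathbf{x}_i'\boldsymbol{\beta}+\varepsilon_i$, $i=1,\ldots,n$, where $\mathbf{x}_i\in\mathbb{R}^p$ are deterministic, $\boldsymbol{\beta}\in\mathbb{R}^p$ is unknown, and $\varepsilon_1,\ldots,\varepsilon_n$ are independent and identically distributed with mean $0$ and variance $\sigma^2$ (with distribution not depending on $n$). $\mathbf{y}=(y_1,\ldots,y_n)'$, and $\mathbf{X}$ is the (nonzero) $n\times p$ matrix with $i$th row $\mathbf{x}_i'$. The dimension $p=p_n$ is a function of $n$ and may exceed $n$; $\boldsymbol{\beta},\mathbf{y},\mathbf{x}_i,\mathbf{X},\boldsymbol{\theta}$ form triangular arrays, with the index $n$ suppressed. Limits and $O(\cdot)$ are as $n\to\infty$ (with $n$ large enough that $\log\log n>0$). Projection: $\boldsymbol{\theta}$ is the orthogonal projection of $\boldsymbol{\beta}$ onto the row space of $\mathbf{X}$; equivalently, if $\mathbf{X}=\mathbf{P}\mathbf{D}\mathbf{Q}'$ is the singular value decomposition with $\mathbf{P}'\mathbf{P}=\mathbf{Q}'\mathbf{Q}=\mathbf{I}_{r}$, $r$ the rank of $\mathbf{X}$ and $\mathbf{D}$ an $r\times r$ nonsingular diagonal matrix, then $\boldsymbol{\theta}=\mathbf{Q}\mathbf{Q}'\boldsymbol{\beta}$. Notation: for a vector $\boldsymbol{\xi}$ and $c>0$, $\mathcal{M}_{\boldsymbol{\xi},c}$ denotes the set of indices of components of $\boldsymbol{\xi}$ whose absolute values are larger than $c$ (so $\mathcal{M}_{\hat{\boldsymbol{\theta}},a_n}$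 is the set of indices of nonzero components after thresholding $\hat{\boldsymbol{\theta}}$ at $a_n$). $n\vee p=\max(n,p)$; $\|\cdot\|$ is the Euclidean norm; $'$ is transpose; $\mathbf{I}_a$ is the identity matrix of order $a$. The requirement $0<\alpha\le(\eta-\xi-\tau)/3$ presupposes that $k$ is large enough that $3l(t+1)/k<\eta-\tau$. *)

theory Defs
  imports
    "HOL-Probability.Probability"
    "HOL-Library.Landau_Symbols"
    "Jordan_Normal_Form.Gauss_Jordan_Elimination"
    "Jordan_Normal_Form.Char_Poly"
    "Jordan_Normal_Form.VS_Connect"
begin

text \<open>
  The dimensions \<open>n\<close> and \<open>p\<^sub>n\<close> vary within the statement, so vectors and matrices are those of
  \<open>Jordan_Normal_Form\<close>, with 0-based indices.  In particular, the observations are indexed by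
  \<open>{..<n}\<close> and the regressors by \<open>{..<p\<^sub>n}\<close>.
\<close>

no_notation vec_nth (infixl \<open>$\<close> 90)
no_notation inner (infix \<open>\<bullet>\<close> 70)
hide_type (open) Finite_Cartesian_Product.vec
hide_const (open) Finite_Cartesian_Product.vec Finite_Cartesian_Product.mat
  Finite_Cartesian_Product.row Finite_Cartesian_Product.transpose

definition euclidean_norm :: "real vec \<Rightarrow> real" where
  "euclidean_norm v = sqrt (v \<bullet> v)"

definition orthogonal_projection_onto :: "real vec set \<Rightarrow> real vec \<Rightarrow> real vec \<Rightarrow> bool" where
  "orthogonal_projection_onto S b v \<longleftrightarrow> v \<in> S \<and> (\<forall>w \<in> S. (b - v) \<bullet> w = 0)"

definition matrix_row_space :: "real mat \<Rightarrow> real vec set" where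
  "matrix_row_space A = vec_space.row_space (dim_col A) A"

definition smallest_positive_eigenvalue :: "real mat \<Rightarrow> real" where
  "smallest_positive_eigenvalue A = Min {e. eigenvalue A e \<and> 0 < e}"

text \<open>
  For \<open>h > 0\<close> the matrix inverted here is positive definite; \<open>the\<close> returns an unspecified matrix
  only when it is singular.
\<close>

definition ridge_estimator :: "real mat \<Rightarrow> real \<Rightarrow> real vec \<Rightarrow> real vec" where
  "ridge_estimator A h v =
     (the (mat_inverse (transpose_mat A * A + h \<cdot>\<^sub>m 1\<^sub>m (dim_col A))) * transpose_mat A) *\<^sub>v v"

definition large_components :: "real vec \<Rightarrow> real \<Rightarrow> nat set" where
  "large_components v c = {j. j < dim_vec v \<and> c < \<bar>v $ j\<bar>}"

end

theory Submission
  imports Defs "HOL-Real_Asymp.Real_Asymp"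
begin

text \<open>
  Since \<open>X \<beta> = X \<theta>\<close>, the error of the ridge estimator is \<open>-h R \<theta> + R X\<^sup>T \<epsilon>\<close> with
  \<open>R = (X\<^sup>T X + h)\<^sup>-\<^sup>1\<close>.  On the row space \<open>R\<close> is bounded by \<open>1 / \<lambda>\<^sub>1\<close>, so the bias is at most
  \<open>h \<parallel>\<theta>\<parallel> / \<lambda>\<^sub>1\<close>, which is \<open>o(a / ln ln n)\<close> by the choice of \<open>\<alpha>\<close>.  Each noise component is a linear
  form in \<open>\<epsilon>\<close> whose squared weights sum to at most \<open>1 / h\<close>, so its \<open>k\<close>-th moment is \<open>O(h\<^sup>-\<^sup>k\<^sup>/\<^sup>2)\<close>; Markov's
  inequality at level of order \<open>a / ln ln n\<close> gives \<open>O((n \<or> p)\<^sup>-\<^sup>(\<^sup>t\<^sup>+\<^sup>1\<^sup>))\<close>, and a union bound over the \<open>p\<close>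
  components costs one power of \<open>n \<or> p\<close>.
\<close>

section \<open>Moments of weighted sums of independent variables\<close>

text \<open>
  The recursion makes \<open>E S\<^sup>q \<le> moment_const m q * r\<^sup>q\<close>, with \<open>r\<^sup>2\<close> the sum of the squared weights,
  inductive in the number of summands: expanding \<open>E (S + b Z)\<^sup>q\<close>, the term linear in \<open>Z\<close> vanishes, the
  others are at most \<open>moment_const m q * b\<^sup>2 * (r')\<^sup>q\<^sup>-\<^sup>2\<close> for \<open>(r')\<^sup>2 = r\<^sup>2 + b\<^sup>2\<close>, and
  \<open>r\<^sup>q + b\<^sup>2 (r')\<^sup>q\<^sup>-\<^sup>2 \<le> (r')\<^sup>q\<close>.
\<close>
fun moment_const :: "(nat \<Rightarrow> real) \<Rightarrow> nat \<Rightarrow> real" where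
  "moment_const m q =
     (if q = 0 then 1 else (\<Sum>j\<in>{2..q}. real (q choose j) * m j * moment_const m (q - j)))"

declare moment_const.simps [simp del]

lemma moment_const_nonneg:
  assumes "\<And>j. 0 \<le> m j"
  shows "0 \<le> moment_const m q"
proof (induction q rule: less_induct)
  case (less q)
  then show ?case
    by (subst moment_const.simps) (auto intro!: sum_nonneg mult_nonneg_nonneg assms)
qed

text \<open>\<open>|z|^j <= 1 + |z|^k\<close> and constants are integrable on a finite measure
  space, so one moment of order \<open>k\<close> supplies all lower ones.\<close>

lemma integrable_power_le:
  fixes f :: "'a \<Rightarrow> real"
  assumes "finite_measure M" "f \<in> borel_measurable M" "integrable M (\<lambda>x. f x ^ k)" "j \<le> k"
  shows "integrable M (\<lambda>x. f x ^ j)"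
proof (rule Bochner_Integration.integrable_bound)
  interpret finite_measure M by fact
  show "integrable M (\<lambda>x. 1 + norm (f x ^ k))"
    using assms(3) by auto
  show "(\<lambda>x. f x ^ j) \<in> borel_measurable M"
    using assms(2) by measurable
  have "\<bar>z\<bar> ^ j \<le> 1 + \<bar>z\<bar> ^ k" for z :: real
  proof (cases "\<bar>z\<bar> \<le> 1")
    case True
    then show ?thesis
      using power_le_one[of "\<bar>z\<bar>" j] zero_le_power[of "\<bar>z\<bar>" k] by linarith
  next
    case False
    then show ?thesis
      using power_increasing[OF assms(4), of "\<bar>z\<bar>"] by linarith
  qed
  then show "AE x in M. norm (f x ^ j) \<le> norm (1 + norm (f x ^ k))"
    by (auto simp: power_abs)
qed

context prob_space
begin

text \<open>Binomial expansion, with each mixed expectation factored by independence. The sum is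
  thereby controlled by the separate moments of \<open>U\<close> and \<open>V\<close>.\<close>

lemma expectation_power_add_indep:
  fixes U V :: "'a \<Rightarrow> real"
  assumes "indep_var borel U borel V"
    and U: "\<And>j. j \<le> q \<Longrightarrow> integrable M (\<lambda>\<omega>. U \<omega> ^ j)"
    and V: "\<And>j. j \<le> q \<Longrightarrow> integrable M (\<lambda>\<omega>. V \<omega> ^ j)"
  shows "integrable M (\<lambda>\<omega>. (U \<omega> + V \<omega>) ^ q)"
    and "expectation (\<lambda>\<omega>. (U \<omega> + V \<omega>) ^ q) =
      (\<Sum>j\<le>q. real (q choose j) * expectation (\<lambda>\<omega>. U \<omega> ^ j) * expectation (\<lambda>\<omega>. V \<omega> ^ (q - j)))"
proof -
  have ind: "indep_var borel (\<lambda>\<omega>. U \<omega> ^ i) borel (\<lambda>\<omega>. V \<omega> ^ j)" for i j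
    using indep_var_compose[OF assms(1), of "\<lambda>x. x ^ i" borel "\<lambda>x. x ^ j" borel]
    by (simp add: comp_def)
  have int: "integrable M (\<lambda>\<omega>. U \<omega> ^ j * V \<omega> ^ (q - j))" if "j \<le> q" for j
    using that by (intro indep_var_integrable ind U V) auto
  have eq: "(U \<omega> + V \<omega>) ^ q = (\<Sum>j\<le>q. real (q choose j) * (U \<omega> ^ j * V \<omega> ^ (q - j)))" for \<omega>
    by (simp add: binomial_ring mult.assoc)
  show "integrable M (\<lambda>\<omega>. (U \<omega> + V \<omega>) ^ q)"
    unfolding eq using int by (intro Bochner_Integration.integrable_sum integrable_mult_right) auto
  show "expectation (\<lambda>\<omega>. (U \<omega> + V \<omega>) ^ q) =
      (\<Sum>j\<le>q. real (q choose j) * expectation (\<lambda>\<omega>. U \<omega> ^ j) * expectation (\<lambda>\<omega>. V \<omega> ^ (q - j)))"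
    unfolding eq
    by (subst Bochner_Integration.integral_sum)
      (auto intro!: sum.cong integrable_mult_right int simp: mult.assoc
        indep_var_lebesgue_integral[OF ind U V])
qed

text \<open>The inequality that closes the induction on the number of summands: \<open>b\<close> is
  the size of the new weight, \<open>r\<close> and \<open>r'\<close> are the norms of the weights
  before and after. Every term keeps two factors \<open>b\<close>; the other \<open>q - 2\<close>
  factors are at most \<open>r'\<close>.\<close>

lemma moment_const_step:
  fixes r r' b :: real
  assumes m: "\<And>j. 0 \<le> m j" and "0 \<le> r" "0 \<le> b" "0 \<le> r'" and r': "r'\<^sup>2 = r\<^sup>2 + b\<^sup>2" and "2 \<le> q"
  shows "moment_const m q * r ^ q +
      (\<Sum>j=2..q. real (q choose j) * (b ^ j * m j) * (moment_const m (q - j) * r ^ (q - j)))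
    \<le> moment_const m q * r' ^ q"
proof -
  have "r\<^sup>2 \<le> r'\<^sup>2" "b\<^sup>2 \<le> r'\<^sup>2"
    using r' by auto
  then have le: "r \<le> r'" "b \<le> r'"
    using assms(4) power2_le_imp_le by blast+
  \<comment> \<open>Writing \<open>q - 2\<close> as \<open>s\<close> avoids truncated subtraction in
    the exponents.\<close>
  obtain s where q: "q = 2 + s"
    using le_Suc_ex[OF \<open>2 \<le> q\<close>] by auto
  have pw: "b ^ j * r ^ (q - j) \<le> b\<^sup>2 * r' ^ s" if "j \<in> {2..q}" for j
  proof -
    have "2 \<le> j"
      using that by simp
    then obtain i where j: "j = 2 + i"
      using le_Suc_ex by blast
    have s: "s = i + (q - j)"
      using that j q by auto
    have "b ^ i * r ^ (q - j) \<le> r' ^ i * r' ^ (q - j)"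
      using assms le by (intro mult_mono power_mono) auto
    then have "b ^ i * r ^ (q - j) \<le> r' ^ s"
      by (subst s) (simp add: power_add)
    then have "b\<^sup>2 * (b ^ i * r ^ (q - j)) \<le> b\<^sup>2 * r' ^ s"
      by (intro mult_left_mono) auto
    then show ?thesis
      by (simp add: j power_add mult_ac power2_eq_square)
  qed
  have "(\<Sum>j=2..q. real (q choose j) * (b ^ j * m j) * (moment_const m (q - j) * r ^ (q - j)))
      = (\<Sum>j=2..q. (real (q choose j) * m j * moment_const m (q - j)) * (b ^ j * r ^ (q - j)))"
    by (simp add: mult_ac)
  also have "\<dots> \<le> (\<Sum>j=2..q. (real (q choose j) * m j * moment_const m (q - j)) * (b\<^sup>2 * r' ^ s))"
    using pw by (intro sum_mono mult_left_mono mult_nonneg_nonneg m moment_const_nonneg) auto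
  also have "\<dots> = moment_const m q * (b\<^sup>2 * r' ^ s)"
    using \<open>2 \<le> q\<close> by (subst (2) moment_const.simps) (simp add: sum_distrib_right)
  finally have "moment_const m q * r ^ q +
      (\<Sum>j=2..q. real (q choose j) * (b ^ j * m j) * (moment_const m (q - j) * r ^ (q - j)))
    \<le> moment_const m q * (r ^ q + b\<^sup>2 * r' ^ s)"
    by (simp add: algebra_simps)
  also have "\<dots> \<le> moment_const m q * r' ^ q"
  proof (intro mult_left_mono moment_const_nonneg m)
    have "r\<^sup>2 * r ^ s \<le> r\<^sup>2 * r' ^ s"
      using assms le by (simp add: q power_add mult_left_mono power_mono)
    moreover have "r ^ q = r\<^sup>2 * r ^ s"
      by (simp add: q power_add power2_eq_square)
    moreover have "r' ^ q = r'\<^sup>2 * r' ^ s"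
      by (simp add: q power_add mult_ac power2_eq_square)
    ultimately show "r ^ q + b\<^sup>2 * r' ^ s \<le> r' ^ q"
      by (simp add: r' algebra_simps)
  qed
  finally show ?thesis .
qed

text \<open>Induction over the index set with \<open>q\<close> general, because the expansion at
  order \<open>q\<close> uses the lower moments of the partial sum. Bounding signed moments by
  \<open>m\<close> is enough, since independence leaves only products of expectations.\<close>

proposition indep_sum_moment_bound:
  fixes Z :: "'i \<Rightarrow> 'a \<Rightarrow> real" and c :: "'i \<Rightarrow> real"
  assumes "finite I" and "indep_vars (\<lambda>_. borel) Z I"
    and "\<And>i j. i \<in> I \<Longrightarrow> j \<le> k \<Longrightarrow> integrable M (\<lambda>\<omega>. Z i \<omega> ^ j)"
    and "\<And>i. i \<in> I \<Longrightarrow> expectation (Z i) = 0"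
    and "\<And>i j. i \<in> I \<Longrightarrow> j \<le> k \<Longrightarrow> \<bar>expectation (\<lambda>\<omega>. Z i \<omega> ^ j)\<bar> \<le> m j"
    and m: "\<And>j. 0 \<le> m j"
    and "q \<le> k"
  shows "integrable M (\<lambda>\<omega>. (\<Sum>i\<in>I. c i * Z i \<omega>) ^ q) \<and>
    \<bar>expectation (\<lambda>\<omega>. (\<Sum>i\<in>I. c i * Z i \<omega>) ^ q)\<bar> \<le> moment_const m q * sqrt (\<Sum>i\<in>I. (c i)\<^sup>2) ^ q"
  using assms(1-5,7)
proof (induction I arbitrary: q rule: finite_induct)
  case empty
  then show ?case
    using moment_const_nonneg[of m q, OF m]
    by (cases "q = 0") (auto simp: moment_const.simps[of m 0] prob_space power_0_left)
next
  case (insert i I)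
  \<comment> \<open>The recursion sums over an empty range at order 1, so the induction hypothesis
    there says that the partial sum has mean zero.\<close>
  have const_1: "moment_const m (Suc 0) = 0"
    by (subst moment_const.simps) simp
  let ?S = "\<lambda>\<omega>. \<Sum>i\<in>I. c i * Z i \<omega>" and ?r = "sqrt (\<Sum>i\<in>I. (c i)\<^sup>2)"
  let ?r' = "sqrt (\<Sum>i\<in>insert i I. (c i)\<^sup>2)"
  let ?U = "\<lambda>\<omega>. c i * Z i \<omega>"
  have IH: "integrable M (\<lambda>\<omega>. ?S \<omega> ^ j)"
    "\<bar>expectation (\<lambda>\<omega>. ?S \<omega> ^ j)\<bar> \<le> moment_const m j * ?r ^ j" if "j \<le> k" for j
    using insert.IH[of j] that insert.prems indep_vars_subset[OF insert.prems(1), of I] by auto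
  have ind: "indep_var borel ?U borel ?S"
  proof (rule indep_vars_sum[OF insert.hyps])
    show "indep_vars (\<lambda>_. borel) (\<lambda>i \<omega>. c i * Z i \<omega>) (insert i I)"
      using insert.prems(1) by (rule indep_vars_compose2) auto
  qed
  have U: "integrable M (\<lambda>\<omega>. ?U \<omega> ^ j)" if "j \<le> k" for j
    using insert.prems(2)[of i j] that by (simp add: power_mult_distrib)
  have EU: "\<bar>expectation (\<lambda>\<omega>. ?U \<omega> ^ j)\<bar> \<le> \<bar>c i\<bar> ^ j * m j" if "j \<le> k" for j
    using insert.prems(4)[of i j] that
    by (simp add: power_mult_distrib abs_mult power_abs mult_left_mono)
  have EU1: "expectation ?U = 0"
    using insert.prems(3)[of i] by simp
  have sum: "(\<Sum>i\<in>insert i I. c i * Z i \<omega>) = ?U \<omega> + ?S \<omega>" for \<omega>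
    using insert.hyps by simp
  have r': "?r'\<^sup>2 = ?r\<^sup>2 + \<bar>c i\<bar>\<^sup>2"
    using insert.hyps by (simp add: sum_nonneg add_nonneg_nonneg)
  have r_nonneg: "0 \<le> ?r" "0 \<le> ?r'"
    by (simp_all only: real_sqrt_ge_0_iff) (simp_all add: sum_nonneg)
  note E = expectation_power_add_indep[OF ind U IH(1), of q]
  have "integrable M (\<lambda>\<omega>. (?U \<omega> + ?S \<omega>) ^ q)"
    using insert.prems(5) by (intro E) auto
  moreover have "\<bar>expectation (\<lambda>\<omega>. (?U \<omega> + ?S \<omega>) ^ q)\<bar> \<le> moment_const m q * ?r' ^ q"
  proof (cases "2 \<le> q")
    case False
    then consider "q = 0" | "q = 1"
      by linarith
    then show ?thesis
    proof cases
      case 1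
      then show ?thesis by (simp add: moment_const.simps prob_space)
    next
      case 2
      have "expectation ?S = 0"
        using IH(2)[of 1] insert.prems(5) 2 by (simp add: const_1)
      moreover have "integrable M ?U" "integrable M ?S"
        using U[of 1] IH(1)[of 1] insert.prems(5) 2 by auto
      ultimately show ?thesis
        using 2 EU1 by (simp add: const_1)
    qed
  next
    case True
    \<comment> \<open>The index 0 contributes the moment of the old sum, and the index 1 vanishes
      because the new summand is centred.\<close>
    have split: "{..q} = {0, 1} \<union> {2..q}"
      using True by auto
    have "expectation (\<lambda>\<omega>. (?U \<omega> + ?S \<omega>) ^ q) =
      (\<Sum>j\<le>q. real (q choose j) * expectation (\<lambda>\<omega>. ?U \<omega> ^ j) * expectation (\<lambda>\<omega>. ?S \<omega> ^ (q - j)))"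
      using insert.prems(5) by (intro E) auto
    also have "\<dots> = expectation (\<lambda>\<omega>. ?S \<omega> ^ q) +
      (\<Sum>j=2..q. real (q choose j) * expectation (\<lambda>\<omega>. ?U \<omega> ^ j) * expectation (\<lambda>\<omega>. ?S \<omega> ^ (q - j)))"
      using EU1 by (subst split, subst sum.union_disjoint) (auto simp: prob_space)
    finally have eq: "expectation (\<lambda>\<omega>. (?U \<omega> + ?S \<omega>) ^ q) = expectation (\<lambda>\<omega>. ?S \<omega> ^ q) +
      (\<Sum>j=2..q. real (q choose j) * expectation (\<lambda>\<omega>. ?U \<omega> ^ j) * expectation (\<lambda>\<omega>. ?S \<omega> ^ (q - j)))" .
    have "\<bar>expectation (\<lambda>\<omega>. (?U \<omega> + ?S \<omega>) ^ q)\<bar> \<le> moment_const m q * ?r ^ q +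
      (\<Sum>j=2..q. real (q choose j) * (\<bar>c i\<bar> ^ j * m j) * (moment_const m (q - j) * ?r ^ (q - j)))"
      unfolding eq
    proof (intro order_trans[OF abs_triangle_ineq] add_mono IH order_trans[OF sum_abs] sum_mono)
      fix j assume "j \<in> {2..q}"
      then show "\<bar>real (q choose j) * expectation (\<lambda>\<omega>. ?U \<omega> ^ j) * expectation (\<lambda>\<omega>. ?S \<omega> ^ (q - j))\<bar>
        \<le> real (q choose j) * (\<bar>c i\<bar> ^ j * m j) * (moment_const m (q - j) * ?r ^ (q - j))"
        using insert.prems(5) unfolding abs_mult
        by (intro mult_mono EU IH mult_nonneg_nonneg m) auto
    qed (fact insert.prems(5))
    also note moment_const_step[OF m r_nonneg(1) abs_ge_zero r_nonneg(2) r' True]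
    finally show ?thesis .
  qed
  ultimately show ?case
    unfolding sum by blast
qed

text \<open>Markov's inequality for the \<open>k\<close>-th power, which is nonnegative and equals
  the power of the absolute value because \<open>k\<close> is even.\<close>

corollary indep_sum_tail_bound:
  fixes Z :: "'i \<Rightarrow> 'a \<Rightarrow> real" and c :: "'i \<Rightarrow> real"
  assumes "finite I" "indep_vars (\<lambda>_. borel) Z I"
    and "\<And>i j. i \<in> I \<Longrightarrow> j \<le> k \<Longrightarrow> integrable M (\<lambda>\<omega>. Z i \<omega> ^ j)"
    and "\<And>i. i \<in> I \<Longrightarrow> expectation (Z i) = 0"
    and "\<And>i j. i \<in> I \<Longrightarrow> j \<le> k \<Longrightarrow> \<bar>expectation (\<lambda>\<omega>. Z i \<omega> ^ j)\<bar> \<le> m j"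
    and "\<And>j. 0 \<le> m j"
    and "even k" "0 < d"
  shows "prob {\<omega> \<in> space M. d \<le> \<bar>\<Sum>i\<in>I. c i * Z i \<omega>\<bar>}
    \<le> moment_const m k * sqrt (\<Sum>i\<in>I. (c i)\<^sup>2) ^ k / d ^ k"
proof -
  let ?S = "\<lambda>\<omega>. \<Sum>i\<in>I. c i * Z i \<omega>"
  have *: "integrable M (\<lambda>\<omega>. ?S \<omega> ^ k)"
    "\<bar>expectation (\<lambda>\<omega>. ?S \<omega> ^ k)\<bar> \<le> moment_const m k * sqrt (\<Sum>i\<in>I. (c i)\<^sup>2) ^ k"
    using indep_sum_moment_bound[OF assms(1-6) order_refl, where c = c] by auto
  have meas: "?S \<in> borel_measurable M"
    using assms(2) unfolding indep_vars_def by (intro borel_measurable_sum) auto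
  have "prob {\<omega> \<in> space M. d \<le> \<bar>?S \<omega>\<bar>} \<le> prob {\<omega> \<in> space M. d ^ k \<le> ?S \<omega> ^ k}"
  proof (rule finite_measure_mono)
    show "{\<omega> \<in> space M. d ^ k \<le> ?S \<omega> ^ k} \<in> events"
      using meas by measurable
    show "{\<omega> \<in> space M. d \<le> \<bar>?S \<omega>\<bar>} \<subseteq> {\<omega> \<in> space M. d ^ k \<le> ?S \<omega> ^ k}"
      using power_mono[of d "\<bar>?S _\<bar>" k] assms(7,8) by (auto simp: power_even_abs)
  qed
  also have "\<dots> \<le> expectation (\<lambda>\<omega>. ?S \<omega> ^ k) / d ^ k"
    using assms(7,8) by (intro integral_Markov_inequality_measure[OF *(1), where A = "{}"])
      (auto simp: zero_le_even_power)
  also have "\<dots> \<le> moment_const m k * sqrt (\<Sum>i\<in>I. (c i)\<^sup>2) ^ k / d ^ k"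
    using *(2) assms(8) by (intro divide_right_mono) auto
  finally show ?thesis .
qed

end

section \<open>The smallest positive eigenvalue of a Gram matrix\<close>

lemma scalar_prod_self_sum:
  fixes v :: "real vec"
  shows "v \<bullet> v = (\<Sum>i<dim_vec v. (v $ i)\<^sup>2)"
  by (simp add: scalar_prod_def power2_eq_square atLeast0LessThan)

lemma scalar_prod_self_nonneg:
  fixes v :: "real vec"
  shows "0 \<le> v \<bullet> v"
  unfolding scalar_prod_self_sum by (simp add: sum_nonneg)

lemma scalar_prod_self_eq_0D:
  fixes v :: "real vec"
  assumes "v \<in> carrier_vec n" "v \<bullet> v = 0"
  shows "v = 0\<^sub>v n"
proof (rule eq_vecI)
  fix i assume "i < dim_vec (0\<^sub>v n :: real vec)"
  then show "v $ i = 0\<^sub>v n $ i"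
    using assms unfolding scalar_prod_self_sum by (subst (asm) sum_nonneg_eq_0_iff) auto
qed (use assms in auto)

lemma Cauchy_Schwarz_vec:
  fixes v w :: "real vec"
  assumes "v \<in> carrier_vec n" "w \<in> carrier_vec n"
  shows "(v \<bullet> w)\<^sup>2 \<le> (v \<bullet> v) * (w \<bullet> w)"
  using Cauchy_Schwarz_ineq_sum[of "\<lambda>i. v $ i" "\<lambda>i. w $ i" "{..<n}"] assms
  by (simp add: scalar_prod_def power2_eq_square atLeast0LessThan)

lemma transpose_mult_scalar:
  fixes A :: "real mat"
  assumes "A \<in> carrier_mat n p" "x \<in> carrier_vec n" "w \<in> carrier_vec p"
  shows "(transpose_mat A *\<^sub>v x) \<bullet> w = x \<bullet> (A *\<^sub>v w)"
  using transpose_vec_mult_scalar[OF assms(1,3,2)] .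

text \<open>This is the row space of \<open>A\<close>, described by equations instead of by
  preimages under the transpose. The description is visibly closed and easy to check for solutions
  of the ridge equation.\<close>

definition kernel_complement :: "real mat \<Rightarrow> real vec set" where
  "kernel_complement A = {v \<in> carrier_vec (dim_col A).
     \<forall>z \<in> carrier_vec (dim_col A). A *\<^sub>v z = 0\<^sub>v (dim_row A) \<longrightarrow> v \<bullet> z = 0}"

lemma transpose_mult_in_kernel_complement:
  assumes A: "A \<in> carrier_mat n p" and x: "x \<in> carrier_vec n"
  shows "transpose_mat A *\<^sub>v x \<in> kernel_complement A"
  using assms transpose_mult_scalar[OF A x] by (auto simp: kernel_complement_def)

lemma kernel_complement_lincomb:
  assumes "v \<in> kernel_complement A" "w \<in> kernel_complement A"
  shows "v + c \<cdot>\<^sub>v w \<in> kernel_complement A"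
  using assms unfolding kernel_complement_def
  by (auto simp: add_scalar_prod_distrib[of _ "dim_col A"])

text \<open>Tychonoff's theorem. It serves the compactness argument below, where vectors are
  represented by functions on all of \<open>nat\<close>.\<close>

lemma compact_function_box:
  fixes S :: "'i \<Rightarrow> real set"
  assumes "\<And>i. compact (S i)"
  shows "compact {f. \<forall>i. f i \<in> S i}"
proof -
  have "compactin (product_topology (\<lambda>_. euclidean) UNIV) (PiE UNIV S)"
    using assms by (subst compactin_PiE) auto
  moreover have "PiE UNIV S = {f. \<forall>i. f i \<in> S i}"
    by auto
  ultimately show ?thesis
    by (simp add: euclidean_product_topology)
qed

text \<open>The Rayleigh quotient of the Gram matrix attains its minimum on the compact unit sphere
  of the complement; scaling extends the inequality to all \<open>w\<close>. Clearing the
  denominator \<open>w \<bullet> w\<close> also covers \<open>w = 0\<close>.\<close>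

lemma kernel_complement_minimiser:
  assumes A: "A \<in> carrier_mat n p" and v0: "v0 \<in> kernel_complement A" "v0 \<noteq> 0\<^sub>v p"
  obtains v where "v \<in> kernel_complement A" "v \<bullet> v = 1"
    "\<And>w. w \<in> kernel_complement A \<Longrightarrow> (A *\<^sub>v v) \<bullet> (A *\<^sub>v v) * (w \<bullet> w) \<le> (A *\<^sub>v w) \<bullet> (A *\<^sub>v w)"
proof -
  let ?V = "kernel_complement A"
  define Z where "Z = {z \<in> carrier_vec p. A *\<^sub>v z = 0\<^sub>v n}"
  \<comment> \<open>The unit sphere of \<open>?V\<close>, with vectors extended by 0 from index
    \<open>p\<close> on. The factors \<open>{0}\<close> and the bound 1 on coordinates of unit
    vectors place it in a compact box; the remaining conditions are closed.\<close>
  define K where "K = {f :: nat \<Rightarrow> real. \<forall>i. f i \<in> (if i < p then {-1..1} else {0})} \<inter>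
    {f. (\<Sum>i<p. (f i)\<^sup>2) = 1} \<inter> (\<Inter>z\<in>Z. {f. (\<Sum>i<p. f i * z $ i) = 0})"
  define g where "g f = (\<Sum>i<n. (\<Sum>j<p. A $$ (i, j) * f j)\<^sup>2)" for f :: "nat \<Rightarrow> real"
  have V: "v \<in> ?V \<longleftrightarrow> v \<in> carrier_vec p \<and> (\<forall>z\<in>Z. (\<Sum>i<p. v $ i * z $ i) = 0)" for v
    using A by (auto simp: kernel_complement_def Z_def scalar_prod_def atLeast0LessThan)
  have "compact K"
    unfolding K_def
    by (intro compact_Int_closed compact_function_box closed_INT closed_Collect_eq
        ballI continuous_intros continuous_on_product_then_coordinatewise continuous_on_id) auto
  have gA: "g f = (A *\<^sub>v vec p f) \<bullet> (A *\<^sub>v vec p f)" for f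
    using A by (simp add: g_def scalar_prod_self_sum) (simp add: scalar_prod_def atLeast0LessThan)
  have in_K: "(\<lambda>i. if i < p then v $ i else 0) \<in> K" if "v \<in> ?V" "v \<bullet> v = 1" for v
  proof -
    have v: "dim_vec v = p" "(\<Sum>i<p. (v $ i)\<^sup>2) = 1"
      using that A by (auto simp: kernel_complement_def scalar_prod_self_sum)
    have "\<bar>v $ i\<bar> \<le> 1" if "i < p" for i
    proof -
      have "(v $ i)\<^sup>2 \<le> 1"
        using that by (subst v(2)[symmetric]) (auto intro!: member_le_sum)
      then show ?thesis
        by (simp add: abs_square_le_1)
    qed
    then show ?thesis
      using v that V[of v] by (auto simp: K_def abs_le_iff)
  qed
  have normalise: "(1 / sqrt (w \<bullet> w)) \<cdot>\<^sub>v w \<in> ?V" "((1 / sqrt (w \<bullet> w)) \<cdot>\<^sub>v w) \<bullet> ((1 / sqrt (w \<bullet> w)) \<cdot>\<^sub>v w) = 1"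
    if "w \<in> ?V" "w \<noteq> 0\<^sub>v p" for w
  proof -
    have w: "w \<in> carrier_vec p"
      using that V by blast
    then have "0 < w \<bullet> w"
      using that scalar_prod_self_nonneg[of w] scalar_prod_self_eq_0D[of w p] by fastforce
    then show "((1 / sqrt (w \<bullet> w)) \<cdot>\<^sub>v w) \<bullet> ((1 / sqrt (w \<bullet> w)) \<cdot>\<^sub>v w) = 1"
      using w by (simp add: field_simps)
    show "(1 / sqrt (w \<bullet> w)) \<cdot>\<^sub>v w \<in> ?V"
      using that(1) by (auto simp: kernel_complement_def)
  qed
  have "K \<noteq> {}"
    using in_K normalise v0 by blast
  moreover have "continuous_on K g"
    unfolding g_def
    by (intro continuous_intros continuous_on_product_then_coordinatewise continuous_on_id)
  ultimately obtain f where f: "f \<in> K" "\<And>f'. f' \<in> K \<Longrightarrow> g f \<le> g f'"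
    using continuous_attains_inf[OF \<open>compact K\<close>] by blast
  show thesis
  proof (rule that[of "vec p f"])
    show "vec p f \<in> ?V"
      using f(1) by (auto simp: V K_def)
    show "vec p f \<bullet> vec p f = 1"
      using f(1) by (auto simp: K_def scalar_prod_self_sum)
    fix w assume w: "w \<in> ?V"
    then have dim_w: "w \<in> carrier_vec p"
      using V by blast
    show "(A *\<^sub>v vec p f) \<bullet> (A *\<^sub>v vec p f) * (w \<bullet> w) \<le> (A *\<^sub>v w) \<bullet> (A *\<^sub>v w)"
    proof (cases "w = 0\<^sub>v p")
      case True
      then show ?thesis
        using scalar_prod_self_nonneg by simp
    next
      case False
      let ?c = "1 / sqrt (w \<bullet> w)"
      have "vec p (\<lambda>i. if i < p then (?c \<cdot>\<^sub>v w) $ i else 0) = ?c \<cdot>\<^sub>v w"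
        using dim_w by (intro eq_vecI) auto
      then have "g f \<le> (A *\<^sub>v (?c \<cdot>\<^sub>v w)) \<bullet> (A *\<^sub>v (?c \<cdot>\<^sub>v w))"
        using f(2)[OF in_K[OF normalise[OF w False]]] unfolding gA by simp
      also have "\<dots> = ?c\<^sup>2 * ((A *\<^sub>v w) \<bullet> (A *\<^sub>v w))"
        using A dim_w by (simp add: mult_mat_vec[OF A dim_w] power2_eq_square)
      also have "?c\<^sup>2 = 1 / (w \<bullet> w)"
        using scalar_prod_self_nonneg[of w] by (simp add: power_divide)
      finally have "(A *\<^sub>v vec p f) \<bullet> (A *\<^sub>v vec p f) \<le> (A *\<^sub>v w) \<bullet> (A *\<^sub>v w) / (w \<bullet> w)"
        by (simp add: gA)
      moreover have "0 < w \<bullet> w"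
        using scalar_prod_self_nonneg[of w] scalar_prod_self_eq_0D[OF dim_w] False by fastforce
      ultimately show ?thesis
        by (simp add: pos_le_divide_eq)
    qed
  qed
qed

text \<open>First-order condition at a minimum. The test point \<open>- b / (q + 1)\<close> makes
  the quadratic negative unless \<open>b = 0\<close>; dividing by \<open>q + 1\<close> and not by
  \<open>q\<close> includes the case \<open>q = 0\<close>.\<close>

lemma quadratic_nonneg_imp_linear_0:
  fixes b q :: real
  assumes "\<And>t. 0 \<le> 2 * t * b + t\<^sup>2 * q" and "0 \<le> q"
  shows "b = 0"
proof (rule ccontr)
  assume "b \<noteq> 0"
  have "2 * (- b / (q + 1)) * b + (- b / (q + 1))\<^sup>2 * q = - (b\<^sup>2 * (q + 2)) / (q + 1)\<^sup>2"
    using \<open>0 \<le> q\<close> by (simp add: divide_simps) (simp add: algebra_simps power2_eq_square)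
  moreover have "0 < b\<^sup>2 * (q + 2) / (q + 1)\<^sup>2"
    using \<open>0 \<le> q\<close> \<open>b \<noteq> 0\<close> by simp
  ultimately show False
    using assms(1)[of "- b / (q + 1)"] by simp
qed

text \<open>The minimiser is perturbed along its own residual \<open>x\<close>, the Gram matrix
  applied to \<open>v\<close> minus \<open>?\<mu>\<close> times \<open>v\<close>, which stays in the
  complement. The first variation equals \<open>x \<bullet> x\<close>, so the residual vanishes. If
  \<open>?\<mu>\<close> were 0, then \<open>v\<close> would lie in the kernel and be orthogonal to
  itself.\<close>

lemma minimiser_eigenvector:
  assumes A: "A \<in> carrier_mat n p" and v: "v \<in> kernel_complement A" "v \<bullet> v = 1"
    and min: "\<And>w. w \<in> kernel_complement A \<Longrightarrow>
      (A *\<^sub>v v) \<bullet> (A *\<^sub>v v) * (w \<bullet> w) \<le> (A *\<^sub>v w) \<bullet> (A *\<^sub>v w)"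
  shows "eigenvalue (transpose_mat A * A) ((A *\<^sub>v v) \<bullet> (A *\<^sub>v v))"
    and "0 < (A *\<^sub>v v) \<bullet> (A *\<^sub>v v)"
proof -
  let ?\<mu> = "(A *\<^sub>v v) \<bullet> (A *\<^sub>v v)"
  let ?w = "transpose_mat A *\<^sub>v (A *\<^sub>v v) + (- ?\<mu>) \<cdot>\<^sub>v v"
  have cv: "v \<in> carrier_vec p" and cAv: "A *\<^sub>v v \<in> carrier_vec n"
    using v A by (auto simp: kernel_complement_def)
  have w: "?w \<in> kernel_complement A"
    by (intro kernel_complement_lincomb transpose_mult_in_kernel_complement[OF A] cAv v)
  then have cw: "?w \<in> carrier_vec p"
    using A by (auto simp: kernel_complement_def)
  define x where "x = ?w"
  have cx: "x \<in> carrier_vec p" and cAx: "A *\<^sub>v x \<in> carrier_vec n" and x: "x \<in> kernel_complement A"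
    using cw A w by (auto simp: x_def)
  \<comment> \<open>Half the derivative at \<open>t = 0\<close> of the gap in the minimality
    inequality at \<open>v + t \<cdot>\<^sub>v x\<close>; the constant term cancels because
    \<open>v \<bullet> v = 1\<close>.\<close>
  define b where "b = (A *\<^sub>v v) \<bullet> (A *\<^sub>v x) - ?\<mu> * (v \<bullet> x)"
  have "b = 0"
  proof (rule quadratic_nonneg_imp_linear_0)
    show "0 \<le> (A *\<^sub>v x) \<bullet> (A *\<^sub>v x) - ?\<mu> * (x \<bullet> x)"
      using min[OF x] by simp
    fix t :: real
    have "?\<mu> * ((v + t \<cdot>\<^sub>v x) \<bullet> (v + t \<cdot>\<^sub>v x)) \<le> (A *\<^sub>v (v + t \<cdot>\<^sub>v x)) \<bullet> (A *\<^sub>v (v + t \<cdot>\<^sub>v x))"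
      by (intro min kernel_complement_lincomb v x)
    moreover have "(v + t \<cdot>\<^sub>v x) \<bullet> (v + t \<cdot>\<^sub>v x) = 1 + 2 * t * (v \<bullet> x) + t\<^sup>2 * (x \<bullet> x)"
      using cv cx v(2)
      by (simp add: add_scalar_prod_distrib[of _ p] scalar_prod_add_distrib[of _ p]
          comm_scalar_prod[of x p v] power2_eq_square algebra_simps)
    moreover have "A *\<^sub>v (v + t \<cdot>\<^sub>v x) = A *\<^sub>v v + t \<cdot>\<^sub>v (A *\<^sub>v x)"
      using A cv cx by (simp add: mult_add_distrib_mat_vec[OF A] mult_mat_vec[OF A])
    moreover have "(A *\<^sub>v v + t \<cdot>\<^sub>v (A *\<^sub>v x)) \<bullet> (A *\<^sub>v v + t \<cdot>\<^sub>v (A *\<^sub>v x)) =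
      ?\<mu> + 2 * t * ((A *\<^sub>v v) \<bullet> (A *\<^sub>v x)) + t\<^sup>2 * ((A *\<^sub>v x) \<bullet> (A *\<^sub>v x))"
      using cAv cAx
      by (simp add: add_scalar_prod_distrib[of _ n] scalar_prod_add_distrib[of _ n]
          comm_scalar_prod[of "A *\<^sub>v x" n "A *\<^sub>v v"] power2_eq_square algebra_simps)
    ultimately show "0 \<le> 2 * t * b + t\<^sup>2 * ((A *\<^sub>v x) \<bullet> (A *\<^sub>v x) - ?\<mu> * (x \<bullet> x))"
      by (simp add: b_def algebra_simps)
  qed
  moreover have "x \<bullet> x = b"
  proof -
    have "x \<bullet> x = (transpose_mat A *\<^sub>v (A *\<^sub>v v)) \<bullet> x + (- ?\<mu>) * (v \<bullet> x)"
      using A cv cx cAv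
      by (subst (1) x_def, subst add_scalar_prod_distrib[of _ p]) auto
    then show ?thesis
      by (simp add: b_def transpose_mult_scalar[OF A cAv cx])
  qed
  ultimately have "x = 0\<^sub>v p"
    using scalar_prod_self_eq_0D[OF cx] by simp
  have "transpose_mat A *\<^sub>v (A *\<^sub>v v) = ?\<mu> \<cdot>\<^sub>v v"
  proof (rule eq_vecI)
    fix i assume "i < dim_vec (?\<mu> \<cdot>\<^sub>v v)"
    moreover from this have "x $ i = 0"
      using \<open>x = 0\<^sub>v p\<close> cv by simp
    ultimately show "(transpose_mat A *\<^sub>v (A *\<^sub>v v)) $ i = (?\<mu> \<cdot>\<^sub>v v) $ i"
      using A cv by (simp add: x_def)
  qed (use A cv in auto)
  moreover have "v \<noteq> 0\<^sub>v p"
    using v(2) cv by auto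
  ultimately show "eigenvalue (transpose_mat A * A) ?\<mu>"
    using A cv by (auto simp: eigenvalue_def eigenvector_def intro!: exI[of _ v])
  show "0 < ?\<mu>"
  proof (rule ccontr)
    assume "\<not> 0 < ?\<mu>"
    then have "A *\<^sub>v v = 0\<^sub>v n"
      using scalar_prod_self_nonneg[of "A *\<^sub>v v"] scalar_prod_self_eq_0D[OF cAv] by simp
    then have "v \<bullet> v = 0"
      using v(1) cv A by (auto simp: kernel_complement_def)
    then show False
      using v(2) by simp
  qed
qed

text \<open>Eigenvalues are roots of the monic characteristic polynomial. Finiteness is what gives
  \<open>Min\<close> in \<open>smallest_positive_eigenvalue\<close> its meaning.\<close>

lemma finite_eigenvalues:
  fixes A :: "real mat"
  assumes A: "A \<in> carrier_mat n n"
  shows "finite {e. eigenvalue A e}"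
proof -
  have "char_poly A \<noteq> 0"
    using degree_monic_char_poly[OF A] by auto
  then show ?thesis
    using poly_roots_finite by (simp add: eigenvalue_root_char_poly[OF A])
qed

text \<open>
  Avoids the spectral theorem: a minimiser of \<open>\<parallel>A v\<parallel>\<^sup>2\<close> on the unit sphere of the complement of the
  kernel is an eigenvector of \<open>A\<^sup>T A\<close>, and its eigenvalue is positive.
\<close>
proposition smallest_positive_eigenvalue_bound:
  assumes A: "A \<in> carrier_mat n p" and "A \<noteq> 0\<^sub>m n p"
  shows "0 < smallest_positive_eigenvalue (transpose_mat A * A)"
    and "w \<in> kernel_complement A \<Longrightarrow>
      smallest_positive_eigenvalue (transpose_mat A * A) * (w \<bullet> w) \<le> (A *\<^sub>v w) \<bullet> (A *\<^sub>v w)"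
proof -
  let ?E = "{e. eigenvalue (transpose_mat A * A) e \<and> 0 < e}"
  obtain i j where ij: "i < n" "j < p" "A $$ (i, j) \<noteq> 0"
    using assms by (metis carrier_matD eq_matI index_zero_mat)
  have unit: "unit_vec n i \<in> carrier_vec n"
    by simp
  \<comment> \<open>Row \<open>i\<close> contains a nonzero entry, so it is a nonzero vector of the
    complement, as the minimiser lemma demands.\<close>
  have "transpose_mat A *\<^sub>v unit_vec n i \<noteq> 0\<^sub>v p"
  proof
    assume "transpose_mat A *\<^sub>v unit_vec n i = 0\<^sub>v p"
    then have "(transpose_mat A *\<^sub>v unit_vec n i) $ j = 0"
      using ij by simp
    then show False
      using A ij by simp
  qed
  then obtain v where v: "v \<in> kernel_complement A" "v \<bullet> v = 1"
    "\<And>w. w \<in> kernel_complement A \<Longrightarrow> (A *\<^sub>v v) \<bullet> (A *\<^sub>v v) * (w \<bullet> w) \<le> (A *\<^sub>v w) \<bullet> (A *\<^sub>v w)"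
    using kernel_complement_minimiser[OF A transpose_mult_in_kernel_complement[OF A unit]] by blast
  have E: "(A *\<^sub>v v) \<bullet> (A *\<^sub>v v) \<in> ?E"
    using minimiser_eigenvector[OF A v] by blast
  have fin: "finite ?E"
    using finite_eigenvalues[of "transpose_mat A * A" p] A by (auto intro: finite_subset[rotated])
  show "0 < smallest_positive_eigenvalue (transpose_mat A * A)"
    unfolding smallest_positive_eigenvalue_def using Min_in[OF fin] E by blast
  assume "w \<in> kernel_complement A"
  then have "(A *\<^sub>v v) \<bullet> (A *\<^sub>v v) * (w \<bullet> w) \<le> (A *\<^sub>v w) \<bullet> (A *\<^sub>v w)"
    by (rule v)
  \<comment> \<open>The minimum of the Rayleigh quotient is itself a positive eigenvalue, hence at
    least the smallest one.\<close>
  moreover have "smallest_positive_eigenvalue (transpose_mat A * A) \<le> (A *\<^sub>v v) \<bullet> (A *\<^sub>v v)"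
    unfolding smallest_positive_eigenvalue_def using Min_le[OF fin E] .
  ultimately show "smallest_positive_eigenvalue (transpose_mat A * A) * (w \<bullet> w) \<le> (A *\<^sub>v w) \<bullet> (A *\<^sub>v w)"
    using scalar_prod_self_nonneg[of w] by (meson mult_right_mono order_trans)
qed

section \<open>Bias and noise of the ridge estimator\<close>

definition ridge_inverse :: "real mat \<Rightarrow> real \<Rightarrow> real mat" where
  "ridge_inverse A h = the (mat_inverse (transpose_mat A * A + h \<cdot>\<^sub>m 1\<^sub>m (dim_col A)))"

lemma ridge_matrix_mult:
  fixes A :: "real mat"
  assumes A: "A \<in> carrier_mat n p" and w: "w \<in> carrier_vec p"
  shows "(transpose_mat A * A + h \<cdot>\<^sub>m 1\<^sub>m p) *\<^sub>v w = transpose_mat A *\<^sub>v (A *\<^sub>v w) + h \<cdot>\<^sub>v w"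
proof -
  have "(h \<cdot>\<^sub>m 1\<^sub>m p) *\<^sub>v w = h \<cdot>\<^sub>v w"
    using w by (intro eq_vecI) auto
  then show ?thesis
    using A w by (subst add_mult_distrib_mat_vec[of _ p p]) auto
qed

lemma ridge_matrix_scalar:
  fixes A :: "real mat"
  assumes A: "A \<in> carrier_mat n p" and w: "w \<in> carrier_vec p" and z: "z \<in> carrier_vec p"
  shows "(transpose_mat A *\<^sub>v (A *\<^sub>v w) + h \<cdot>\<^sub>v w) \<bullet> z = (A *\<^sub>v w) \<bullet> (A *\<^sub>v z) + h * (w \<bullet> z)"
  using A w z by (subst add_scalar_prod_distrib[of _ p]) (auto simp: transpose_mult_scalar[OF A])

text \<open>A vector \<open>v\<close> in the kernel of the ridge matrix satisfies \<open>(A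
  *\<^sub>v v) \<bullet> (A *\<^sub>v v) + h * (v \<bullet> v) = 0\<close>, so \<open>v = 0\<close>.
  Hence \<open>mat_inverse\<close> succeeds and \<open>the\<close> returns a true inverse.\<close>

lemma ridge_inverse:
  assumes A: "A \<in> carrier_mat n p" and h: "0 < h"
  shows ridge_inverse_carrier: "ridge_inverse A h \<in> carrier_mat p p"
    and ridge_inverse_solves: "b \<in> carrier_vec p \<Longrightarrow>
      transpose_mat A *\<^sub>v (A *\<^sub>v (ridge_inverse A h *\<^sub>v b)) + h \<cdot>\<^sub>v (ridge_inverse A h *\<^sub>v b) = b"
proof -
  let ?G = "transpose_mat A * A + h \<cdot>\<^sub>m 1\<^sub>m p"
  have G: "?G \<in> carrier_mat p p"
    using A by auto
  have "det ?G \<noteq> 0"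
  proof
    assume "det ?G = 0"
    then obtain v where v: "v \<in> carrier_vec p" "v \<noteq> 0\<^sub>v p" "?G *\<^sub>v v = 0\<^sub>v p"
      using det_0_iff_vec_prod_zero_field[OF G] by blast
    have "(A *\<^sub>v v) \<bullet> (A *\<^sub>v v) + h * (v \<bullet> v) = 0"
      using ridge_matrix_scalar[OF A v(1) v(1), where h = h] ridge_matrix_mult[OF A v(1), where h = h]
        v(1) v(3)
      by (metis scalar_prod_left_zero)
    then have "h * (v \<bullet> v) = 0"
      using scalar_prod_self_nonneg[of v] scalar_prod_self_nonneg[of "A *\<^sub>v v"] h
      by (smt (verit) mult_nonneg_nonneg)
    then show False
      using scalar_prod_self_eq_0D[OF v(1)] v(2) h by simp
  qed
  then have "?G \<in> Units (ring_mat TYPE(real) p ())"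
    by (rule det_non_zero_imp_unit[OF G])
  then obtain R where R: "mat_inverse ?G = Some R"
    using mat_inverse(1)[OF G, where b = "()"] by (cases "mat_inverse ?G") auto
  have eq: "ridge_inverse A h = R"
    using A R by (simp add: ridge_inverse_def)
  show carrier: "ridge_inverse A h \<in> carrier_mat p p"
    using mat_inverse(2)[OF G R] eq by simp
  assume b: "b \<in> carrier_vec p"
  then have "?G *\<^sub>v (ridge_inverse A h *\<^sub>v b) = b"
    using mat_inverse(2)[OF G R] eq assoc_mult_mat_vec[OF G carrier b] by simp
  then show "transpose_mat A *\<^sub>v (A *\<^sub>v (ridge_inverse A h *\<^sub>v b)) + h \<cdot>\<^sub>v (ridge_inverse A h *\<^sub>v b) = b"
    using ridge_matrix_mult[OF A, of "ridge_inverse A h *\<^sub>v b" h] carrier b by simp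
qed

text \<open>The vector \<open>A *\<^sub>v r\<close> holds the noise weights of component
  \<open>j\<close>. Pairing the equation for \<open>r\<close> with \<open>r\<close> itself bounds
  their squared norm by \<open>x - h * x^2\<close> at \<open>x = r $ j\<close>.\<close>

lemma ridge_weight_bound:
  fixes A :: "real mat"
  assumes A: "A \<in> carrier_mat n p" and h: "0 < h" and j: "j < p"
    and r: "r \<in> carrier_vec p" "transpose_mat A *\<^sub>v (A *\<^sub>v r) + h \<cdot>\<^sub>v r = unit_vec p j"
  shows "(A *\<^sub>v r) \<bullet> (A *\<^sub>v r) \<le> 1 / h"
proof -
  have eq: "(A *\<^sub>v r) \<bullet> (A *\<^sub>v r) + h * (r \<bullet> r) = r $ j"
    using ridge_matrix_scalar[OF A r(1) r(1), where h = h] r j by simp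
  have "(r $ j)\<^sup>2 \<le> r \<bullet> r"
    unfolding scalar_prod_self_sum using r(1) j by (auto intro!: member_le_sum)
  then have "h * (r $ j)\<^sup>2 \<le> h * (r \<bullet> r)"
    using h by simp
  then have "(A *\<^sub>v r) \<bullet> (A *\<^sub>v r) \<le> r $ j - h * (r $ j)\<^sup>2"
    using eq by simp
  also have "\<dots> \<le> 1 / h"
  proof -
    \<comment> \<open>Completing the square gives the maximum \<open>1 / (4 * h)\<close>; the weaker
      \<open>1 / h\<close> suffices.\<close>
    have "0 \<le> (h * r $ j - 1 / 2)\<^sup>2"
      by simp
    then have "h * (r $ j - h * (r $ j)\<^sup>2) \<le> 1"
      by (simp add: power2_eq_square algebra_simps)
    then show ?thesis
      using h by (simp add: field_simps)
  qed
  finally show ?thesis .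
qed

text \<open>Pairing the equation with kernel vectors shows that \<open>w\<close> inherits
  orthogonality to the kernel from \<open>\<theta>\<close>, so the eigenvalue bound applies to
  \<open>w\<close>. Pairing with \<open>w\<close> and Cauchy-Schwarz then bound the norm of
  \<open>w\<close>.\<close>

lemma ridge_bias_bound:
  assumes A: "A \<in> carrier_mat n p" and A0: "A \<noteq> 0\<^sub>m n p" and h: "0 < h"
    and \<theta>: "\<theta> \<in> kernel_complement A"
    and w: "w \<in> carrier_vec p" "transpose_mat A *\<^sub>v (A *\<^sub>v w) + h \<cdot>\<^sub>v w = \<theta>" and j: "j < p"
  shows "\<bar>w $ j\<bar> \<le> euclidean_norm \<theta> / smallest_positive_eigenvalue (transpose_mat A * A)"
proof -
  let ?lam = "smallest_positive_eigenvalue (transpose_mat A * A)"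
  have lam: "0 < ?lam"
    by (rule smallest_positive_eigenvalue_bound[OF A A0])
  have c\<theta>: "\<theta> \<in> carrier_vec p"
    using \<theta> A by (auto simp: kernel_complement_def)
  have "w \<in> kernel_complement A"
  proof -
    have "w \<bullet> z = 0" if z: "z \<in> carrier_vec p" "A *\<^sub>v z = 0\<^sub>v n" for z
    proof -
      have "\<theta> \<bullet> z = 0"
        using \<theta> z A by (auto simp: kernel_complement_def)
      moreover have "A *\<^sub>v w \<in> carrier_vec n"
        using A w by simp
      ultimately have "h * (w \<bullet> z) = 0"
        using ridge_matrix_scalar[OF A w(1) z(1), where h = h] w(2) z(2) by simp
      then show ?thesis
        using h by simp
    qed
    then show ?thesis
      using w(1) A by (auto simp: kernel_complement_def)
  qed
  then have "?lam * (w \<bullet> w) \<le> (A *\<^sub>v w) \<bullet> (A *\<^sub>v w)"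
    by (rule smallest_positive_eigenvalue_bound[OF A A0])
  also have "\<dots> \<le> \<theta> \<bullet> w"
    using ridge_matrix_scalar[OF A w(1) w(1), where h = h] w(2) h scalar_prod_self_nonneg[of w] by simp
  also have "\<dots> \<le> euclidean_norm \<theta> * euclidean_norm w"
    unfolding euclidean_norm_def real_sqrt_mult[symmetric]
    by (rule real_le_rsqrt[OF Cauchy_Schwarz_vec[OF c\<theta> w(1)]])
  also have "w \<bullet> w = euclidean_norm w * euclidean_norm w"
    using scalar_prod_self_nonneg[of w] by (simp add: euclidean_norm_def)
  finally have "(?lam * euclidean_norm w) * euclidean_norm w \<le> euclidean_norm \<theta> * euclidean_norm w"
    by (simp add: mult.assoc)
  moreover have nonneg: "0 \<le> euclidean_norm w" "0 \<le> euclidean_norm \<theta>"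
    by (simp_all add: euclidean_norm_def scalar_prod_self_nonneg)
  ultimately have "?lam * euclidean_norm w \<le> euclidean_norm \<theta>"
    by (cases "euclidean_norm w = 0") auto
  then have "euclidean_norm w \<le> euclidean_norm \<theta> / ?lam"
    using lam by (simp add: field_simps)
  moreover have "\<bar>w $ j\<bar> \<le> euclidean_norm w"
    unfolding euclidean_norm_def scalar_prod_self_sum using w(1) j
    by (intro real_le_rsqrt) (auto intro!: member_le_sum)
  ultimately show ?thesis
    by simp
qed

section \<open>Projection onto the row space and the error of the ridge estimator\<close>

lemma matrix_row_space_eq:
  assumes "A \<in> carrier_mat n p"
  shows "matrix_row_space A = {transpose_mat A *\<^sub>v x | x. x \<in> carrier_vec n}"
proof -
  have dims: "dim_col A = p" "dim_row A = n"
    using assms by auto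
  have "matrix_row_space A =
      {w \<in> carrier_vec p. \<exists>x\<in>carrier_vec n. transpose_mat A *\<^sub>v x = w}"
    unfolding matrix_row_space_def dims by (rule vec_space.row_space_eq[OF assms, unfolded dims])
  also have "\<dots> = {transpose_mat A *\<^sub>v x | x. x \<in> carrier_vec n}"
    using assms by auto
  finally show ?thesis .
qed

text \<open>The residual \<open>\<beta> - \<theta>\<close> is orthogonal to the row space, in
  particular to the Gram matrix applied to it, so \<open>A\<close> maps it to 0. The observations
  therefore see \<open>\<beta>\<close> only through \<open>\<theta>\<close>.\<close>

lemma projection_mult_eq:
  assumes A: "A \<in> carrier_mat n p" and \<beta>: "\<beta> \<in> carrier_vec p"
    and proj: "orthogonal_projection_onto (matrix_row_space A) \<beta> \<theta>"
  shows "\<theta> \<in> kernel_complement A" "A *\<^sub>v \<beta> = A *\<^sub>v \<theta>"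
proof -
  obtain x where x: "x \<in> carrier_vec n" "\<theta> = transpose_mat A *\<^sub>v x"
    using proj unfolding orthogonal_projection_onto_def matrix_row_space_eq[OF A] by blast
  then show "\<theta> \<in> kernel_complement A"
    using transpose_mult_in_kernel_complement[OF A] by blast
  have \<theta>: "\<theta> \<in> carrier_vec p"
    using x A by simp
  then have c: "A *\<^sub>v (\<beta> - \<theta>) \<in> carrier_vec n" "\<beta> - \<theta> \<in> carrier_vec p"
    using A \<beta> by auto
  have t: "transpose_mat A *\<^sub>v (A *\<^sub>v (\<beta> - \<theta>)) \<in> carrier_vec p"
    using A c by simp
  have "(\<beta> - \<theta>) \<bullet> (transpose_mat A *\<^sub>v (A *\<^sub>v (\<beta> - \<theta>))) = 0"
    using proj c(1) unfolding orthogonal_projection_onto_def matrix_row_space_eq[OF A] by blast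
  then have "(A *\<^sub>v (\<beta> - \<theta>)) \<bullet> (A *\<^sub>v (\<beta> - \<theta>)) = 0"
    unfolding transpose_mult_scalar[OF A c(1,2), symmetric] comm_scalar_prod[OF c(2) t] .
  then have 0: "A *\<^sub>v \<beta> - A *\<^sub>v \<theta> = 0\<^sub>v n"
    using scalar_prod_self_eq_0D[OF c(1)] mult_minus_distrib_mat_vec[OF A \<beta> \<theta>] by simp
  show "A *\<^sub>v \<beta> = A *\<^sub>v \<theta>"
  proof (rule eq_vecI)
    fix i assume "i < dim_vec (A *\<^sub>v \<theta>)"
    then show "(A *\<^sub>v \<beta>) $ i = (A *\<^sub>v \<theta>) $ i"
      using arg_cong[OF 0, of "\<lambda>v. v $ i"] A \<beta> \<theta> by simp
  qed (use A in auto)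
qed

lemma dim_ridge_estimator:
  assumes "A \<in> carrier_mat n p" "0 < h"
  shows "dim_vec (ridge_estimator A h v) = p"
  using ridge_inverse_carrier[OF assms] by (simp add: ridge_estimator_def ridge_inverse_def)

text \<open>
  With \<open>r\<close> solving \<open>(A\<^sup>TA + h) r = e\<^sub>j\<close>, symmetry gives
  \<open>\<theta>hat\<^sub>j = r \<bullet> A\<^sup>T y = (A r) \<bullet> (A \<theta>) + (A r) \<bullet> e\<close> and \<open>(A r) \<bullet> (A \<theta>) = \<theta>\<^sub>j - h (r \<bullet> \<theta>)\<close>.
\<close>
proposition ridge_estimator_decomposition:
  assumes A: "A \<in> carrier_mat n p" and A0: "A \<noteq> 0\<^sub>m n p" and h: "0 < h"
    and \<beta>: "\<beta> \<in> carrier_vec p"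
    and proj: "orthogonal_projection_onto (matrix_row_space A) \<beta> \<theta>"
  obtains b :: "nat \<Rightarrow> real" and c :: "nat \<Rightarrow> nat \<Rightarrow> real"
  where "\<And>j. j < p \<Longrightarrow>
      \<bar>b j\<bar> \<le> h * euclidean_norm \<theta> / smallest_positive_eigenvalue (transpose_mat A * A)"
    and "\<And>j. j < p \<Longrightarrow> (\<Sum>i<n. (c j i)\<^sup>2) \<le> 1 / h"
    and "\<And>j e. j < p \<Longrightarrow> ridge_estimator A h (vec n (\<lambda>i. row A i \<bullet> \<beta> + e i)) $ j =
      \<theta> $ j + b j + (\<Sum>i<n. c j i * e i)"
proof -
  define R where "R = ridge_inverse A h"
  note cR = ridge_inverse_carrier[OF A h, folded R_def]
  note solves = ridge_inverse_solves[OF A h, folded R_def]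
  define r where "r j = R *\<^sub>v unit_vec p j" for j
  have r: "r j \<in> carrier_vec p"
    "transpose_mat A *\<^sub>v (A *\<^sub>v r j) + h \<cdot>\<^sub>v r j = unit_vec p j" for j
    using cR solves[of "unit_vec p j"] by (auto simp: r_def)
  note \<theta> = projection_mult_eq[OF A \<beta> proj]
  have c\<theta>: "\<theta> \<in> carrier_vec p"
    using \<theta>(1) A by (auto simp: kernel_complement_def)
  \<comment> \<open>Symmetry of \<open>R\<close>, read off from the symmetric form \<open>(A
    *\<^sub>v v) \<bullet> (A *\<^sub>v w) + h * (v \<bullet> w)\<close> evaluated at
    \<open>r j\<close> and \<open>R *\<^sub>v b\<close>.\<close>
  have swap: "r j \<bullet> b = (R *\<^sub>v b) $ j" if "b \<in> carrier_vec p" "j < p" for b j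
  proof -
    have Rb: "R *\<^sub>v b \<in> carrier_vec p"
      using cR that by simp
    have "(R *\<^sub>v b) $ j = (A *\<^sub>v r j) \<bullet> (A *\<^sub>v (R *\<^sub>v b)) + h * (r j \<bullet> (R *\<^sub>v b))"
      using ridge_matrix_scalar[OF A r(1)[of j] Rb, where h = h] r(2)[of j] Rb that(2) by simp
    also have "\<dots> = (A *\<^sub>v (R *\<^sub>v b)) \<bullet> (A *\<^sub>v r j) + h * ((R *\<^sub>v b) \<bullet> r j)"
      using A Rb r(1)[of j]
      by (simp add: comm_scalar_prod[of _ p] comm_scalar_prod[of "A *\<^sub>v r j" n])
    also have "\<dots> = b \<bullet> r j"
      using ridge_matrix_scalar[OF A Rb r(1)[of j], where h = h] solves[OF that(1)] by simp
    also have "\<dots> = r j \<bullet> b"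
      by (rule comm_scalar_prod[OF that(1) r(1)])
    finally show ?thesis ..
  qed
  show thesis
  proof (rule that[of "\<lambda>j. - h * (r j \<bullet> \<theta>)" "\<lambda>j i. (A *\<^sub>v r j) $ i"])
    fix j assume j: "j < p"
    \<comment> \<open>By \<open>swap\<close>, the bias of component \<open>j\<close> is
      \<open>- h\<close> times component \<open>j\<close> of
      \<open>R *\<^sub>v \<theta>\<close>.\<close>
    have "\<bar>(R *\<^sub>v \<theta>) $ j\<bar> \<le> euclidean_norm \<theta> / smallest_positive_eigenvalue (transpose_mat A * A)"
      using cR c\<theta> by (intro ridge_bias_bound[OF A A0 h \<theta>(1) _ solves[OF c\<theta>] j]) auto
    then have "h * \<bar>(R *\<^sub>v \<theta>) $ j\<bar> \<le>
        h * (euclidean_norm \<theta> / smallest_positive_eigenvalue (transpose_mat A * A))"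
      using h by (intro mult_left_mono) auto
    then show "\<bar>- h * (r j \<bullet> \<theta>)\<bar> \<le>
        h * euclidean_norm \<theta> / smallest_positive_eigenvalue (transpose_mat A * A)"
      using h swap[OF c\<theta> j] by (simp add: abs_mult)
    show "(\<Sum>i<n. ((A *\<^sub>v r j) $ i)\<^sup>2) \<le> 1 / h"
      using ridge_weight_bound[OF A h j r[of j]] A by (simp add: scalar_prod_self_sum)
    fix e :: "nat \<Rightarrow> real"
    let ?y = "vec n (\<lambda>i. row A i \<bullet> \<beta> + e i)"
    have y: "?y = A *\<^sub>v \<theta> + vec n e"
      using A by (intro eq_vecI) (auto simp: \<theta>(2)[symmetric])
    have cy: "?y \<in> carrier_vec n" "transpose_mat A *\<^sub>v ?y \<in> carrier_vec p"
      using A by auto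
    have Ar: "A *\<^sub>v r j \<in> carrier_vec n"
      using A r(1) by simp
    have "ridge_estimator A h ?y = R *\<^sub>v (transpose_mat A *\<^sub>v ?y)"
      using A cR cy(1) unfolding ridge_estimator_def ridge_inverse_def[symmetric] R_def
      by (intro assoc_mult_mat_vec) auto
    then have "ridge_estimator A h ?y $ j = r j \<bullet> (transpose_mat A *\<^sub>v ?y)"
      using swap[OF cy(2) j] by simp
    also have "\<dots> = ?y \<bullet> (A *\<^sub>v r j)"
      unfolding transpose_mult_scalar[OF A cy(1) r(1), symmetric] by (rule comm_scalar_prod[OF r(1) cy(2)])
    also have "\<dots> = (A *\<^sub>v r j) \<bullet> ?y"
      by (rule comm_scalar_prod[OF cy(1) Ar])
    also have "\<dots> = (A *\<^sub>v r j) \<bullet> (A *\<^sub>v \<theta>) + (A *\<^sub>v r j) \<bullet> vec n e"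
      unfolding y using A c\<theta> by (intro scalar_prod_add_distrib[OF Ar]) auto
    also have "(A *\<^sub>v r j) \<bullet> (A *\<^sub>v \<theta>) = \<theta> $ j - h * (r j \<bullet> \<theta>)"
      using ridge_matrix_scalar[OF A r(1)[of j] c\<theta>, where h = h] r(2)[of j] c\<theta> j by simp
    also have "(A *\<^sub>v r j) \<bullet> vec n e = (\<Sum>i<n. (A *\<^sub>v r j) $ i * e i)"
      by (simp add: scalar_prod_def atLeast0LessThan)
    finally show "ridge_estimator A h ?y $ j =
        \<theta> $ j + - h * (r j \<bullet> \<theta>) + (\<Sum>i<n. (A *\<^sub>v r j) $ i * e i)"
      by simp
  qed
qed

section \<open>Thresholding\<close>

text \<open>Triangle inequality: an error of at most \<open>\<delta>\<close> cannot carry a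
  component across the gap from \<open>a * u\<close> to \<open>a\<close>, or from \<open>a\<close>
  to \<open>a / u\<close>.\<close>

lemma large_components_sandwich:
  assumes "dim_vec v = p" "dim_vec w = p" "\<And>j. j < p \<Longrightarrow> \<bar>w $ j - v $ j\<bar> \<le> \<delta>"
    and "a + \<delta> \<le> a * u" "a / u + \<delta> \<le> a"
  shows "large_components v (a * u) \<subseteq> large_components w a"
    and "large_components w a \<subseteq> large_components v (a / u)"
  using assms(1,2,4,5) assms(3) unfolding large_components_def by fastforce+

text \<open>Rewrites an inclusion as finitely many conditions on components, which makes the event
  measurable.\<close>

lemma large_components_subset_iff:
  assumes "dim_vec v = p" "dim_vec w = p"
  shows "large_components v c \<subseteq> large_components w d \<longleftrightarrow>
    (\<forall>j\<in>{..<p}. c < \<bar>v $ j\<bar> \<longrightarrow> d < \<bar>w $ j\<bar>)"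
  unfolding large_components_def assms by blast

text \<open>Bias and noise each receive a budget \<open>d\<close>. If the inclusions fail, some
  noise component has size at least \<open>d\<close>; a union bound over the \<open>p\<close>
  components and the moment tail bound with weights of norm at most \<open>1 / sqrt h\<close>
  finish.\<close>

lemma (in prob_space) thresholding_probability:
  fixes Z :: "nat \<Rightarrow> 'a \<Rightarrow> real"
  assumes A: "A \<in> carrier_mat n p" and A0: "A \<noteq> 0\<^sub>m n p" and h: "0 < h"
    and \<beta>: "\<beta> \<in> carrier_vec p"
    and proj: "orthogonal_projection_onto (matrix_row_space A) \<beta> \<theta>"
    and Z: "indep_vars (\<lambda>_. borel) Z {..<n}"
      "\<And>i j. i < n \<Longrightarrow> j \<le> k \<Longrightarrow> integrable M (\<lambda>\<omega>. Z i \<omega> ^ j)"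
      "\<And>i. i < n \<Longrightarrow> expectation (Z i) = 0"
      "\<And>i j. i < n \<Longrightarrow> j \<le> k \<Longrightarrow> \<bar>expectation (\<lambda>\<omega>. Z i \<omega> ^ j)\<bar> \<le> m j"
    and m: "\<And>j. 0 \<le> m j" and k: "even k" and d: "0 < d"
    and bias: "h * euclidean_norm \<theta> / smallest_positive_eigenvalue (transpose_mat A * A) \<le> d"
    and au: "a + 2 * d \<le> a * u" "a / u + 2 * d \<le> a"
  defines "\<theta>hat \<equiv> \<lambda>\<omega>. ridge_estimator A h (vec n (\<lambda>i. row A i \<bullet> \<beta> + Z i \<omega>))"
  shows "1 - prob {\<omega> \<in> space M. large_components \<theta> (a * u) \<subseteq> large_components (\<theta>hat \<omega>) a \<and>
        large_components (\<theta>hat \<omega>) a \<subseteq> large_components \<theta> (a / u)}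
      \<le> real p * (moment_const m k / (sqrt h * d) ^ k)"
proof -
  obtain b c where b': "\<And>j. j < p \<Longrightarrow>
      \<bar>b j\<bar> \<le> h * euclidean_norm \<theta> / smallest_positive_eigenvalue (transpose_mat A * A)"
    and c: "\<And>j. j < p \<Longrightarrow> (\<Sum>i<n. (c j i)\<^sup>2) \<le> 1 / h"
    and eq': "\<And>j e. j < p \<Longrightarrow> ridge_estimator A h (vec n (\<lambda>i. row A i \<bullet> \<beta> + e i)) $ j =
      \<theta> $ j + b j + (\<Sum>i<n. c j i * e i)"
    by (rule ridge_estimator_decomposition[OF A A0 h \<beta> proj]) blast
  have b: "\<bar>b j\<bar> \<le> d" if "j < p" for j
    using b'[OF that] bias by linarith
  have eq: "\<theta>hat \<omega> $ j = \<theta> $ j + b j + (\<Sum>i<n. c j i * Z i \<omega>)" if "j < p" for \<omega> j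
    unfolding \<theta>hat_def by (rule eq'[OF that])
  have dim: "dim_vec \<theta> = p" "dim_vec (\<theta>hat \<omega>) = p" for \<omega>
    using projection_mult_eq[OF A \<beta> proj] A dim_ridge_estimator[OF A h]
    by (auto simp: kernel_complement_def \<theta>hat_def)
  let ?S = "\<lambda>j \<omega>. \<Sum>i<n. c j i * Z i \<omega>"
  let ?good = "{\<omega> \<in> space M. large_components \<theta> (a * u) \<subseteq> large_components (\<theta>hat \<omega>) a \<and>
        large_components (\<theta>hat \<omega>) a \<subseteq> large_components \<theta> (a / u)}"
  have meas [measurable]: "?S j \<in> borel_measurable M" for j
    using Z(1) unfolding indep_vars_def
    by (intro borel_measurable_sum borel_measurable_times borel_measurable_const) auto
  have tail: "{\<omega> \<in> space M. x < \<bar>\<theta>hat \<omega> $ j\<bar>} \<in> events" if "j < p" for j x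
    unfolding eq[OF that] by measurable
  have good: "?good \<in> events"
    unfolding large_components_subset_iff[OF dim] large_components_subset_iff[OF dim(2,1)]
    by (intro sets.sets_Collect_conj sets.sets_Collect_countable_All' sets.sets_Collect_imp
        sets.sets_Collect_const tail) auto
  have "1 - prob ?good = prob (space M - ?good)"
    using prob_compl[OF good] by simp
  also have "\<dots> \<le> prob (\<Union>j<p. {\<omega> \<in> space M. d \<le> \<bar>?S j \<omega>\<bar>})"
  proof (rule finite_measure_mono)
    show "(\<Union>j<p. {\<omega> \<in> space M. d \<le> \<bar>?S j \<omega>\<bar>}) \<in> events"
      by measurable
    show "space M - ?good \<subseteq> (\<Union>j<p. {\<omega> \<in> space M. d \<le> \<bar>?S j \<omega>\<bar>})"
    proof
      fix \<omega> assume \<omega>: "\<omega> \<in> space M - ?good"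
      show "\<omega> \<in> (\<Union>j<p. {\<omega> \<in> space M. d \<le> \<bar>?S j \<omega>\<bar>})"
      proof (rule ccontr)
        assume "\<omega> \<notin> (\<Union>j<p. {\<omega> \<in> space M. d \<le> \<bar>?S j \<omega>\<bar>})"
        then have S: "\<bar>?S j \<omega>\<bar> \<le> d" if "j < p" for j
          using \<omega> that by force
        have "\<bar>\<theta>hat \<omega> $ j - \<theta> $ j\<bar> \<le> 2 * d" if "j < p" for j
          using S[OF that] b[OF that] eq[OF that, of \<omega>] by linarith
        then show False
          using large_components_sandwich[OF dim(1) dim(2)[of \<omega>] _ au] \<omega> by auto
      qed
    qed
  qed
  also have "\<dots> \<le> (\<Sum>j<p. prob {\<omega> \<in> space M. d \<le> \<bar>?S j \<omega>\<bar>})"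
    by (intro finite_measure_subadditive_finite) (auto simp: image_subset_iff)
  also have "\<dots> \<le> (\<Sum>j<p. moment_const m k / (sqrt h * d) ^ k)"
  proof (rule sum_mono)
    fix j assume "j \<in> {..<p}"
    then have "sqrt (\<Sum>i<n. (c j i)\<^sup>2) \<le> 1 / sqrt h"
      using real_sqrt_le_mono[OF c[of j]] by (simp add: real_sqrt_divide)
    then have "sqrt (\<Sum>i<n. (c j i)\<^sup>2) ^ k \<le> (1 / sqrt h) ^ k"
      by (intro power_mono) (auto simp: sum_nonneg)
    then have "moment_const m k * sqrt (\<Sum>i<n. (c j i)\<^sup>2) ^ k / d ^ k
        \<le> moment_const m k * (1 / sqrt h) ^ k / d ^ k"
      using d moment_const_nonneg[of m k, OF m] by (intro divide_right_mono mult_left_mono) auto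
    also have "\<dots> = moment_const m k / (sqrt h * d) ^ k"
      by (simp add: power_divide power_mult_distrib)
    finally show "prob {\<omega> \<in> space M. d \<le> \<bar>?S j \<omega>\<bar>} \<le> moment_const m k / (sqrt h * d) ^ k"
      using indep_sum_tail_bound[of "{..<n}" Z k m d "c j"] Z m k d by fastforce
  qed
  also have "\<dots> = real p * (moment_const m k / (sqrt h * d) ^ k)"
    by simp
  finally show ?thesis .
qed

section \<open>Asymptotic rates for bias and noise\<close>

text \<open>
  The bias exponent is \<open>2\<alpha> + 2\<xi>/3 + \<tau> - \<eta> \<le> - \<alpha> - \<xi>/3\<close>; the surplus \<open>\<xi>/3\<close> absorbs the
  iterated logarithms.
\<close>
lemma ridge_bias_asymptotics:
  fixes h \<nu> lam N :: "nat \<Rightarrow> real"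
  assumes lam: "(\<lambda>n. inverse (lam n)) \<in> O(\<lambda>n. real n powr (- \<eta>))"
    and \<nu>: "\<nu> \<in> O(\<lambda>n. real n powr \<tau>)"
    and N: "N \<in> O(\<lambda>n. real n powr l)" "\<And>n. 0 \<le> N n"
    and pos: "0 < C1" "0 < C2" "0 < l" "0 < \<xi>" "0 < d"
    and \<alpha>: "\<alpha> \<le> (\<eta> - \<xi> - \<tau>) / 3"
  shows "\<forall>\<^sub>F n in sequentially.
    C2 * inverse ((C1 * real n powr (- \<alpha>))\<^sup>2) * (ln (ln (real n)))\<^sup>2 * N n powr (2 * \<xi> / (3 * l)) * \<nu> n / lam n
      \<le> d * (C1 * real n powr (- \<alpha>)) / (1 + ln (ln (real n)))"
proof -
  let ?L = "\<lambda>n. ln (ln (real n))"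
  obtain c1 where c1: "0 < c1" "\<forall>\<^sub>F n in sequentially. norm (inverse (lam n)) \<le> c1 * norm (real n powr (- \<eta>))"
    using lam by (elim landau_o.bigE)
  obtain c2 where c2: "0 < c2" "\<forall>\<^sub>F n in sequentially. norm (\<nu> n) \<le> c2 * norm (real n powr \<tau>)"
    using \<nu> by (elim landau_o.bigE)
  obtain c3 where c3: "0 < c3" "\<forall>\<^sub>F n in sequentially. norm (N n) \<le> c3 * norm (real n powr l)"
    using N by (elim landau_o.bigE)
  \<comment> \<open>The exponent of \<open>N\<close> in the ridge parameter; since \<open>N\<close>
    is of order at most \<open>n^l\<close>, this power has order at most
    \<open>n^(2 * \<xi> / 3)\<close>, free of \<open>l\<close>.\<close>
  define e where "e = 2 * \<xi> / (3 * l)"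
  have e: "0 < e" "l * e = 2 * \<xi> / 3"
    using pos by (auto simp: e_def)
  define K where "K = C2 / C1\<^sup>2 * c3 powr e * c2 * c1"
  \<comment> \<open>The factor \<open>1 + ?L n\<close> is the denominator of the target bound, moved
    to the left; the negative power of \<open>n\<close> beats all iterated logarithms.\<close>
  have "((\<lambda>n. K * (?L n)\<^sup>2 * (1 + ?L n) * real n powr (- \<xi> / 3)) \<longlongrightarrow> 0) sequentially"
    using pos(4) by real_asymp
  then have "\<forall>\<^sub>F n in sequentially. K * (?L n)\<^sup>2 * (1 + ?L n) * real n powr (- \<xi> / 3) < d * C1"
    using pos by (intro order_tendstoD) auto
  moreover have "\<forall>\<^sub>F n in sequentially. 1 \<le> ?L n"
    by real_asymp
  ultimately show ?thesis
    using c1(2) c2(2) c3(2) eventually_ge_at_top[of 1]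
  proof eventually_elim
    case (elim n)
    let ?x = "real n"
    have x: "1 \<le> ?x"
      using elim by simp
    have L: "0 < 1 + ?L n"
      using elim by simp
    have Ne: "N n powr e \<le> c3 powr e * ?x powr (2 * \<xi> / 3)"
    proof -
      have "N n powr e \<le> (c3 * ?x powr l) powr e"
        using elim N(2)[of n] e by (intro powr_mono2) auto
      then show ?thesis
        using c3 e by (simp add: powr_mult powr_powr)
    qed
    have nl: "\<nu> n / lam n \<le> (c2 * ?x powr \<tau>) * (c1 * ?x powr (- \<eta>))"
    proof -
      have "\<nu> n / lam n \<le> \<bar>\<nu> n\<bar> * \<bar>inverse (lam n)\<bar>"
        by (metis abs_ge_self abs_mult divide_inverse)
      also have "\<dots> \<le> (c2 * ?x powr \<tau>) * (c1 * ?x powr (- \<eta>))"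
        using elim c2 by (intro mult_mono) auto
      finally show ?thesis .
    qed
    have inv: "inverse ((C1 * ?x powr (- \<alpha>))\<^sup>2) = ?x powr (2 * \<alpha>) / C1\<^sup>2"
      using x by (simp add: power_mult_distrib powr_minus field_simps power2_eq_square powr_add[symmetric])
    have "C2 * inverse ((C1 * ?x powr (- \<alpha>))\<^sup>2) * (?L n)\<^sup>2 * N n powr e * \<nu> n / lam n
      = (C2 * (?x powr (2 * \<alpha>) / C1\<^sup>2) * (?L n)\<^sup>2) * (N n powr e * (\<nu> n / lam n))"
      unfolding inv by simp
    also have "\<dots> \<le> (C2 * (?x powr (2 * \<alpha>) / C1\<^sup>2) * (?L n)\<^sup>2) *
        ((c3 powr e * ?x powr (2 * \<xi> / 3)) * ((c2 * ?x powr \<tau>) * (c1 * ?x powr (- \<eta>))))"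
    proof (rule mult_left_mono)
      have "N n powr e * (\<nu> n / lam n) \<le> N n powr e * ((c2 * ?x powr \<tau>) * (c1 * ?x powr (- \<eta>)))"
        by (intro mult_left_mono nl) auto
      also have "\<dots> \<le> (c3 powr e * ?x powr (2 * \<xi> / 3)) * ((c2 * ?x powr \<tau>) * (c1 * ?x powr (- \<eta>)))"
        using c1 c2 by (intro mult_right_mono Ne) auto
      finally show "N n powr e * (\<nu> n / lam n)
        \<le> (c3 powr e * ?x powr (2 * \<xi> / 3)) * ((c2 * ?x powr \<tau>) * (c1 * ?x powr (- \<eta>)))" .
    qed (use pos in auto)
    also have "\<dots> = K * (?L n)\<^sup>2 * (?x powr (2 * \<alpha>) * ?x powr (2 * \<xi> / 3) * ?x powr \<tau> * ?x powr (- \<eta>))"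
      by (simp add: K_def)
    also have "?x powr (2 * \<alpha>) * ?x powr (2 * \<xi> / 3) * ?x powr \<tau> * ?x powr (- \<eta>)
        = ?x powr (2 * \<alpha> + 2 * \<xi> / 3 + \<tau> - \<eta>)"
      by (simp add: powr_add[symmetric])
    also have "K * (?L n)\<^sup>2 * ?x powr (2 * \<alpha> + 2 * \<xi> / 3 + \<tau> - \<eta>)
        \<le> K * (?L n)\<^sup>2 * (?x powr (- \<xi> / 3) * ?x powr (- \<alpha>))"
    proof (rule mult_left_mono)
      \<comment> \<open>Comparing exponents gives exactly
        \<open>3 * \<alpha> \<le> \<eta> - \<xi> - \<tau>\<close>.\<close>
      show "?x powr (2 * \<alpha> + 2 * \<xi> / 3 + \<tau> - \<eta>) \<le> ?x powr (- \<xi> / 3) * ?x powr (- \<alpha>)"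
        unfolding powr_add[symmetric] using \<alpha> x by (intro powr_mono) (auto simp: field_simps)
    qed (use pos c1 c2 in \<open>auto simp: K_def\<close>)
    also have "\<dots> = (K * (?L n)\<^sup>2 * (1 + ?L n) * ?x powr (- \<xi> / 3)) * ?x powr (- \<alpha>) / (1 + ?L n)"
      using L by simp
    also have "\<dots> \<le> (d * C1) * ?x powr (- \<alpha>) / (1 + ?L n)"
      using elim L by (intro divide_right_mono mult_right_mono) auto
    finally show ?case
      by (simp add: e_def mult.assoc)
  qed
qed

text \<open>The factor \<open>a\<close> cancels between \<open>sqrt h\<close> and the noise level.
  As \<open>L \<ge> 1\<close>, the ratio \<open>L / (1 + L)\<close> is at least
  \<open>1 / 2\<close>, which with the factor \<open>1 / 4\<close> gives \<open>1 / 8\<close>; the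
  \<open>k\<close>-th power turns the rest into \<open>N powr (t + 1)\<close>.\<close>

lemma ridge_scale_bound:
  fixes k :: nat and N L a C t :: real
  assumes "0 < a" "0 < C" "1 \<le> L" "1 \<le> N" "0 < k"
  defines "h \<equiv> C * inverse (a\<^sup>2) * L\<^sup>2 * N powr (2 * (t + 1) / k)"
  shows "(sqrt C / 8) ^ k * N powr (t + 1) \<le> (sqrt h * (a / (1 + L) / 4)) ^ k"
proof -
  have "N powr (2 * (t + 1) / k) = (N powr ((t + 1) / k))\<^sup>2"
    using assms by (simp add: power2_eq_square powr_add[symmetric] add_divide_distrib[symmetric])
  then have "h = (sqrt C * (L / a) * N powr ((t + 1) / k))\<^sup>2"
    using assms by (simp add: h_def power_mult_distrib power_divide divide_inverse power_inverse)
  then have "sqrt h = sqrt C * (L / a) * N powr ((t + 1) / k)"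
    using assms by simp
  then have "sqrt h * (a / (1 + L) / 4) = sqrt C * (L / (1 + L) / 4) * N powr ((t + 1) / k)"
    using assms by simp
  moreover have "1 / 8 \<le> L / (1 + L) / 4"
    using assms by (simp add: field_simps)
  then have "sqrt C * (1 / 8) * N powr ((t + 1) / k) \<le> sqrt C * (L / (1 + L) / 4) * N powr ((t + 1) / k)"
    using assms by (intro mult_right_mono mult_left_mono) auto
  ultimately have "(sqrt C / 8 * N powr ((t + 1) / k)) ^ k \<le> (sqrt h * (a / (1 + L) / 4)) ^ k"
    using assms by (intro power_mono) auto
  moreover have "(N powr ((t + 1) / k)) ^ k = N powr (t + 1)"
    using powr_realpow[of "N powr ((t + 1) / k)" k] assms by (simp add: powr_powr)
  ultimately show ?thesis
    by (simp only: power_mult_distrib)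
qed

theorem mainTheorem4:
  fixes M :: "'a measure"
    and \<epsilon> :: "nat \<Rightarrow> nat \<Rightarrow> 'a \<Rightarrow> real"
    and D :: "real measure"
    and p :: "nat \<Rightarrow> nat"
    and X :: "nat \<Rightarrow> real mat"
    and \<beta> \<theta> :: "nat \<Rightarrow> real vec"
    and y \<theta>hat :: "nat \<Rightarrow> 'a \<Rightarrow> real vec"
    and lam1 a u h :: "nat \<Rightarrow> real"
    and k :: nat
    and \<sigma> \<eta> \<tau> l t \<xi> \<alpha> C1 C2 :: real
  assumes prob: "prob_space M"
    and X_dim: "\<And>n. n \<ge> 1 \<Longrightarrow> X n \<in> carrier_mat n (p n)"
    and X_nonzero: "\<And>n. n \<ge> 1 \<Longrightarrow> X n \<noteq> 0\<^sub>m n (p n)"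
    and \<beta>_dim: "\<And>n. n \<ge> 1 \<Longrightarrow> \<beta> n \<in> carrier_vec (p n)"
    and \<epsilon>_indep: "\<And>n. n \<ge> 1 \<Longrightarrow> prob_space.indep_vars M (\<lambda>i. borel) (\<epsilon> n) {..<n}"
    and \<epsilon>_distr: "\<And>n i. n \<ge> 1 \<Longrightarrow> i < n \<Longrightarrow> distr M borel (\<epsilon> n i) = D"
    and \<epsilon>_integrable: "\<And>n i. n \<ge> 1 \<Longrightarrow> i < n \<Longrightarrow> integrable M (\<epsilon> n i)"
    and \<epsilon>_mean: "\<And>n i. n \<ge> 1 \<Longrightarrow> i < n \<Longrightarrow> prob_space.expectation M (\<epsilon> n i) = 0"
    and \<epsilon>_square_integrable: "\<And>n i. n \<ge> 1 \<Longrightarrow> i < n \<Longrightarrow> integrable M (\<lambda>\<omega>. (\<epsilon> n i \<omega>)\<^sup>2)"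
    and \<epsilon>_variance: "\<And>n i. n \<ge> 1 \<Longrightarrow> i < n \<Longrightarrow> prob_space.variance M (\<epsilon> n i) = \<sigma>\<^sup>2"
    and y_def: "\<And>n \<omega>. n \<ge> 1 \<Longrightarrow> \<omega> \<in> space M \<Longrightarrow>
                  y n \<omega> = vec n (\<lambda>i. row (X n) i \<bullet> \<beta> n + \<epsilon> n i \<omega>)"
    and \<theta>_proj: "\<And>n. n \<ge> 1 \<Longrightarrow>
                  orthogonal_projection_onto (matrix_row_space (X n)) (\<beta> n) (\<theta> n)"
    and \<theta>hat_def: "\<And>n \<omega>. n \<ge> 1 \<Longrightarrow> \<omega> \<in> space M \<Longrightarrow>
                  \<theta>hat n \<omega> = ridge_estimator (X n) (h n) (y n \<omega>)"
    and lam1_def: "\<And>n. n \<ge> 1 \<Longrightarrow>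
                  lam1 n = smallest_positive_eigenvalue (transpose_mat (X n) * X n)"
    and k_even: "even k"
    and \<epsilon>_moment: "\<And>n i. n \<ge> 1 \<Longrightarrow> i < n \<Longrightarrow> integrable M (\<lambda>\<omega>. \<epsilon> n i \<omega> ^ k)"
    and lam1_rate: "(\<lambda>n. inverse (lam1 n)) \<in> O(\<lambda>n. real n powr (- \<eta>))"
    and \<eta>_le: "\<eta> \<le> 1"
    and \<theta>_rate: "(\<lambda>n. euclidean_norm (\<theta> n)) \<in> O(\<lambda>n. real n powr \<tau>)"
    and \<tau>_less: "\<tau> < \<eta>"
    and p_rate: "(\<lambda>n. real (p n)) \<in> O(\<lambda>n. real n powr l)"
    and l_bounds: "1 \<le> l" "l < real k / 6"
    and t_pos: "0 < t"
    and \<xi>_def: "\<xi> = 3 * l * (t + 1) / real k"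
    and C1_pos: "0 < C1"
    and \<alpha>_bounds: "0 < \<alpha>" "\<alpha> \<le> 1 / 2" "\<alpha> \<le> (\<eta> - \<xi> - \<tau>) / 3"
    and a_def: "\<And>n. n \<ge> 1 \<Longrightarrow> a n = C1 * real n powr (- \<alpha>)"
    and u_def: "\<And>n. n \<ge> 1 \<Longrightarrow> u n = 1 + inverse (ln (ln (real n)))"
    and C2_pos: "0 < C2"
    and h_def: "\<And>n. n \<ge> 1 \<Longrightarrow>
                  h n = C2 * inverse ((a n)\<^sup>2) * (ln (ln (real n)))\<^sup>2
                          * real (max n (p n)) powr (2 * \<xi> / (3 * l))"
  shows "(\<lambda>n. 1 - measure M {\<omega> \<in> space M.
             large_components (\<theta> n) (a n * u n) \<subseteq> large_components (\<theta>hat n \<omega>) (a n) \<and>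
             large_components (\<theta>hat n \<omega>) (a n) \<subseteq> large_components (\<theta> n) (a n / u n)})
         \<in> O(\<lambda>n. real (max n (p n)) powr (- t))"
proof -
  interpret prob_space M by (rule prob)
  have k: "0 < k" "0 < l"
    using l_bounds by (auto intro: gr0I)
  have \<xi>: "0 < \<xi>" "2 * \<xi> / (3 * l) = 2 * (t + 1) / real k"
    using k t_pos by (simp_all add: \<xi>_def nonzero_divide_eq_eq nonzero_eq_divide_eq)
  \<comment> \<open>Moments of the common law \<open>D\<close>, so the bounds, and with them
    \<open>K\<close>, depend on neither \<open>n\<close> nor \<open>i\<close>.\<close>
  define m where "m j = \<bar>\<integral>x. x ^ j \<partial>D\<bar>" for j :: nat
  have \<epsilon>_meas: "\<epsilon> n i \<in> borel_measurable M" if "n \<ge> 1" "i < n" for n i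
    using \<epsilon>_integrable[OF that] by auto
  have m: "\<bar>expectation (\<lambda>\<omega>. \<epsilon> n i \<omega> ^ j)\<bar> \<le> m j" if "n \<ge> 1" "i < n" for n i j
    unfolding m_def \<epsilon>_distr[OF that, symmetric]
    by (subst integral_distr[OF \<epsilon>_meas[OF that]]) auto
  define K where "K = moment_const m k / (sqrt C2 / 8) ^ k"
  define N where "N n = real (max n (p n))" for n
  have N_rate: "N \<in> O(\<lambda>n. real n powr l)"
  proof -
    \<comment> \<open>Here \<open>1 \<le> l\<close> enters: the sample size obeys the same rate as
      the dimension.\<close>
    have "(\<lambda>n. real n) \<in> O(\<lambda>n. real n powr l)"
    proof (rule bigoI[where c = 1])
      show "\<forall>\<^sub>F n in sequentially. norm (real n) \<le> 1 * norm (real n powr l)"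
        using eventually_ge_at_top[of 1]
      proof eventually_elim
        case (elim n)
        then show ?case
          using powr_mono[of 1 l "real n"] l_bounds by simp
      qed
    qed
    then have "(\<lambda>n. real n + real (p n)) \<in> O(\<lambda>n. real n powr l)"
      using p_rate by (rule sum_in_bigo)
    moreover have "N \<in> O(\<lambda>n. real n + real (p n))"
      by (rule bigoI[where c = 1]) (auto simp: N_def intro!: always_eventually)
    ultimately show ?thesis
      using landau_o.big_trans by blast
  qed
  have "\<forall>\<^sub>F n in sequentially.
      C2 * inverse ((C1 * real n powr (- \<alpha>))\<^sup>2) * (ln (ln (real n)))\<^sup>2 * N n powr (2 * \<xi> / (3 * l))
        * euclidean_norm (\<theta> n) / lam1 n
      \<le> 1 / 4 * (C1 * real n powr (- \<alpha>)) / (1 + ln (ln (real n)))"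
    by (rule ridge_bias_asymptotics[OF lam1_rate \<theta>_rate N_rate _ C1_pos C2_pos k(2) \<xi>(1) _ \<alpha>_bounds(3)])
      (simp_all add: N_def)
  moreover have "\<forall>\<^sub>F n in sequentially. 1 \<le> ln (ln (real n))"
    by real_asymp
  ultimately have "\<forall>\<^sub>F n in sequentially. norm (1 - prob {\<omega> \<in> space M.
             large_components (\<theta> n) (a n * u n) \<subseteq> large_components (\<theta>hat n \<omega>) (a n) \<and>
             large_components (\<theta>hat n \<omega>) (a n) \<subseteq> large_components (\<theta> n) (a n / u n)})
         \<le> K * norm (N n powr (- t))"
    using eventually_ge_at_top[of 1]
  proof eventually_elim
    case (elim n)
    \<comment> \<open>Since \<open>u n = 1 + 1 / ?L\<close>, the gaps around \<open>a n\<close> are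
      \<open>a n / ?L\<close> above and \<open>a n / (1 + ?L)\<close> below. A quarter of the
      smaller one leaves room for \<open>2 * ?d\<close> on both sides.\<close>
    let ?L = "ln (ln (real n))" and ?d = "a n / (1 + ln (ln (real n))) / 4"
    let ?est = "\<lambda>\<omega>. ridge_estimator (X n) (h n) (vec n (\<lambda>i. row (X n) i \<bullet> \<beta> n + \<epsilon> n i \<omega>))"
    have n: "n \<ge> 1" and L: "1 \<le> ?L"
      using elim by auto
    have a: "0 < a n"
      using n C1_pos by (simp add: a_def)
    have N: "1 \<le> N n" "real (p n) \<le> N n"
      using n by (auto simp: N_def)
    have h: "h n = C2 * inverse ((a n)\<^sup>2) * ?L\<^sup>2 * N n powr (2 * (t + 1) / real k)"
      unfolding h_def[OF n] \<xi>(2) N_def ..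
    then have h_pos: "0 < h n"
      using a C2_pos L N by simp
    \<comment> \<open>The estimator and the observations are specified only on the sample space, so
      they are unfolded inside the event.\<close>
    have "1 - prob {\<omega> \<in> space M.
             large_components (\<theta> n) (a n * u n) \<subseteq> large_components (\<theta>hat n \<omega>) (a n) \<and>
             large_components (\<theta>hat n \<omega>) (a n) \<subseteq> large_components (\<theta> n) (a n / u n)}
      = 1 - prob {\<omega> \<in> space M.
             large_components (\<theta> n) (a n * u n) \<subseteq> large_components (?est \<omega>) (a n) \<and>
             large_components (?est \<omega>) (a n) \<subseteq> large_components (\<theta> n) (a n / u n)}"
      by (intro arg_cong[where f = "\<lambda>S. 1 - prob S"]) (auto simp: \<theta>hat_def[OF n] y_def[OF n])
    also have "\<dots> \<le> real (p n) * (moment_const m k / (sqrt (h n) * ?d) ^ k)"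
    proof (rule thresholding_probability[OF X_dim[OF n] X_nonzero[OF n] h_pos \<beta>_dim[OF n] \<theta>_proj[OF n]
          \<epsilon>_indep[OF n] _ \<epsilon>_mean[OF n] m[OF n] _ k_even])
      fix i j assume "i < n" "j \<le> k"
      then show "integrable M (\<lambda>\<omega>. \<epsilon> n i \<omega> ^ j)"
        using integrable_power_le[OF finite_measure_axioms \<epsilon>_meas[OF n] \<epsilon>_moment[OF n]] by blast
    next
      show "h n * euclidean_norm (\<theta> n) / smallest_positive_eigenvalue (transpose_mat (X n) * X n) \<le> ?d"
        using elim(1) unfolding lam1_def[OF n, symmetric] h_def[OF n] a_def[OF n] N_def
        by (simp add: mult.commute)
      show "a n + 2 * ?d \<le> a n * u n" "a n / u n + 2 * ?d \<le> a n"
        using a L by (auto simp: u_def[OF n] divide_simps) (auto simp: algebra_simps)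
    qed (use a L in \<open>auto simp: m_def\<close>)
    \<comment> \<open>The union bound costs a factor \<open>p n \<le> N n\<close>, one power of the
      available \<open>N n powr (t + 1)\<close>, which leaves the rate \<open>- t\<close>.\<close>
    also have "\<dots> \<le> N n * (moment_const m k / ((sqrt C2 / 8) ^ k * N n powr (t + 1)))"
    proof (intro mult_mono divide_left_mono)
      show "(sqrt C2 / 8) ^ k * N n powr (t + 1) \<le> (sqrt (h n) * ?d) ^ k"
        unfolding h using ridge_scale_bound[OF a C2_pos L N(1) k(1)] .
      show "0 \<le> moment_const m k"
        by (rule moment_const_nonneg) (simp add: m_def)
      then show "0 \<le> moment_const m k / (sqrt (h n) * ?d) ^ k"
        using a L h_pos by simp
    qed (use N a L h_pos C2_pos in auto)
    also have "\<dots> = K * N n powr (- t)"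
      using N by (simp add: K_def powr_add powr_minus field_simps)
    finally show ?case
      using prob_le_1 by (simp add: K_def)
  qed
  then show ?thesis
    unfolding N_def by (rule bigoI)
qed

end
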